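(* Let $D$ be a pseudosingular GPVD, let $K$ be the field of fractions of $D$, and let $E$ be a nonempty subset of $K$. Let $T$ be the associated Prüfer domain of $D$. Then $\mathrm{Int}^{\mathrm{R}}(E,D)$ is a GPVD with associated Prüfer domain $\mathrm{Int}^{\mathrm{R}}(E,T)$.
   Context: Domains are commutative integral domains. For a domain $A$ with field of fractions $K$ and $E\subseteq K$, $\mathrm{Int}^{\mathrm{R}}(E,A)=\{\varphi\in K(x)\mid \varphi(a)\in A \text{ for all } a\in E\}$ (the condition $\varphi(a)\in A$ includes that $\varphi$ is defined at $a$). An extension of commutative rings $A\subseteq B$ is unibranched if the contraction map $\mathrm{Spec}(B)\to\mathrm{Spec}(A)$ is a bijection. A domain $D$ is a globalized pseudovaluation domain (GPVD) if there exists a Prüfer domain $T$ containing $D$ such that (i) $D\subseteq T$ is a unibranched extension, and (ii) there exists a nonzero radical ideal $J$ common to $D$ and $T$ such that each prime ideal of $T$ containing $J$ is maximal in $T$ and each prime ideal of $D$ containing $J$ is maximal in $D$. The Prüfer domain $T$ is uniquely determined and is called the associated Prüfer domain of $D$. A Prüfer domain $T$ is singular if there exists a family $\Lambda$ of maximal ideals of $T$ such that: $T=\bigcap_{\mathfrak m\in\Lambda}T_{\mathfrak m}$; for each $\mathfrak m\in\Lambda$ the maximal ideal of $T_{\mathfrak m}$ is principal, generated by some $t_{\mathfrak m}\in T_{\mathfrak m}$; and there exist $t\in T$ and $n\in\mathbb N$ such that for each $\mathfrak m\in\Lambda$ we have $0<v_{\mathfrak m}(t)<n\,v_{\mathfrak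 m}(t_{\mathfrak m})$, where $v_{\mathfrak m}$ is a valuation associated with $T_{\mathfrak m}$. A GPVD is pseudosingular if its associated Prüfer domain is singular. *)

theory Defs
  imports
    "HOL-Algebra.Algebraic_Closure_Type"
    "HOL-Algebra.Ideal_Product"
    "HOL-Computational_Algebra.Fraction_Field"
begin

text \<open>
  Integral domains are represented as subrings \<open>A\<close> of a field that is given by a type of class
  \<^class>\<open>field\<close>; \<open>ring_on A\<close> is \<open>A\<close> with the operations of that field, viewed as a structure of
  HOL-Algebra.  Every domain arises in this way inside its field of fractions.
\<close>

abbreviation ring_on :: "'a::field set \<Rightarrow> 'a ring"
  where "ring_on A \<equiv> ring_of_type_algebra\<lparr>carrier := A\<rparr>"

abbreviation is_domain :: "'a::field set \<Rightarrow> bool"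
  where "is_domain A \<equiv> subdomain A ring_of_type_algebra"

definition fraction_field :: "'a::field set \<Rightarrow> 'a set"
  where "fraction_field A = {a / b |a b. a \<in> A \<and> b \<in> A \<and> b \<noteq> 0}"

definition localization_at :: "'a::field set \<Rightarrow> 'a set \<Rightarrow> 'a set"
  where "localization_at A P = {a / s |a s. a \<in> A \<and> s \<in> A \<and> s \<notin> P}"


section \<open>Integer-valued rational functions\<close>

text \<open>
  \<open>rat_fun_value \<phi> a c\<close>: the rational function \<open>\<phi>\<close> is defined at \<open>a\<close>, i.e. it has some
  representation as a quotient whose denominator does not vanish at \<open>a\<close>, and its value there is \<open>c\<close>.
\<close>

definition rat_fun_value :: "'k::field poly fract \<Rightarrow> 'k \<Rightarrow> 'k \<Rightarrow> bool"
  where "rat_fun_value \<phi> a c \<longleftrightarrow>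
    (\<exists>p q. \<phi> = Fract p q \<and> poly q a \<noteq> 0 \<and> c = poly p a / poly q a)"

lemma rat_fun_value_unique:
  assumes "rat_fun_value \<phi> a c" "rat_fun_value \<phi> a d"
  shows "c = d"
proof -
  obtain p q where 1: "\<phi> = Fract p q" "poly q a \<noteq> 0" "c = poly p a / poly q a"
    using assms(1) unfolding rat_fun_value_def by blast
  obtain r s where 2: "\<phi> = Fract r s" "poly s a \<noteq> 0" "d = poly r a / poly s a"
    using assms(2) unfolding rat_fun_value_def by blast
  have "q \<noteq> 0" "s \<noteq> 0" using 1 2 by auto
  then have "p * s = r * q" using 1(1) 2(1) by (simp add: eq_fract)
  then have "poly p a * poly s a = poly r a * poly q a" by (metis poly_mult)
  then show ?thesis using 1 2 by (simp add: frac_eq_eq)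
qed

text \<open>
  The set \<open>Int\<^sup>R(E, A)\<close>.  The type \<open>'k\<close> plays the role of the field \<open>K\<close>, so \<open>A\<close> is meant to satisfy
  \<open>fraction_field A = UNIV\<close>; the value at \<open>a\<close> is unique by \<open>rat_fun_value_unique\<close>.
\<close>

definition int_rat :: "'k::field set \<Rightarrow> 'k set \<Rightarrow> 'k poly fract set"
  where "int_rat E A = {\<phi>. \<forall>a\<in>E. \<exists>c\<in>A. rat_fun_value \<phi> a c}"


section \<open>Pruefer domains and globalized pseudovaluation domains\<close>

definition ideal_inverse :: "'a::field set \<Rightarrow> 'a set \<Rightarrow> 'a set"
  where "ideal_inverse A I = {x \<in> fraction_field A. \<forall>a\<in>I. x * a \<in> A}"

definition invertible_ideal :: "'a::field set \<Rightarrow> 'a set \<Rightarrow> bool"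
  where "invertible_ideal A I \<longleftrightarrow> I \<cdot>\<^bsub>ring_of_type_algebra\<^esub> ideal_inverse A I = A"

text \<open>Every nonzero finitely generated ideal is invertible.\<close>

definition pruefer_domain :: "'a::field set \<Rightarrow> bool"
  where "pruefer_domain A \<longleftrightarrow> is_domain A \<and>
    (\<forall>S. finite S \<longrightarrow> S \<subseteq> A \<longrightarrow> genideal (ring_on A) S \<noteq> {0} \<longrightarrow>
       invertible_ideal A (genideal (ring_on A) S))"

definition Spec :: "('a, 'b) ring_scheme \<Rightarrow> 'a set set"
  where "Spec R = {P. primeideal P R}"

definition unibranched :: "'a::field set \<Rightarrow> 'a set \<Rightarrow> bool"
  where "unibranched A B \<longleftrightarrow> A \<subseteq> B \<and> bij_betw (\<lambda>Q. Q \<inter> A) (Spec (ring_on B)) (Spec (ring_on A))"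

definition radical_ideal :: "'a set \<Rightarrow> ('a, 'b) ring_scheme \<Rightarrow> bool"
  where "radical_ideal I R \<longleftrightarrow> ideal I R \<and> {x \<in> carrier R. \<exists>n::nat. x [^]\<^bsub>R\<^esub> n \<in> I} = I"

text \<open>
  It is no restriction that \<open>T\<close> is taken inside the given field: if \<open>J\<close> is a nonzero common ideal of
  \<open>D\<close> and \<open>T\<close>, then \<open>t = t j / j\<close> with \<open>0 \<noteq> j \<in> J\<close> shows that \<open>T\<close> is contained in the field of fractions
  of \<open>D\<close>.
\<close>

definition associated_pruefer_domain :: "'a::field set \<Rightarrow> 'a set \<Rightarrow> bool"
  where "associated_pruefer_domain D T \<longleftrightarrow>
    is_domain D \<and> pruefer_domain T \<and> unibranched D T \<and>
    (\<exists>J. J \<noteq> {0} \<and> radical_ideal J (ring_on D) \<and> radical_ideal J (ring_on T) \<and>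
      (\<forall>Q. primeideal Q (ring_on T) \<and> J \<subseteq> Q \<longrightarrow> maximalideal Q (ring_on T)) \<and>
      (\<forall>P. primeideal P (ring_on D) \<and> J \<subseteq> P \<longrightarrow> maximalideal P (ring_on D)))"

definition gpvd :: "'a::field set \<Rightarrow> bool"
  where "gpvd D \<longleftrightarrow> (\<exists>T. associated_pruefer_domain D T)"


section \<open>The valuation associated with a valuation domain\<close>

text \<open>
  The value group of a valuation domain \<open>V\<close> with field of fractions \<open>F\<close> is \<open>F\<^sup>* / V\<^sup>*\<close>.  It is written
  multiplicatively, so the multiple \<open>n \<cdot> \<gamma>\<close> is a power; \<^const>\<open>None\<close> is the value \<open>\<infinity>\<close> of \<open>0\<close>.
\<close>

definition value_group :: "'a::field set \<Rightarrow> 'a set monoid"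
  where "value_group V = mult_of (ring_on (fraction_field V)) Mod Units (ring_on V)"

definition valuation :: "'a::field set \<Rightarrow> 'a \<Rightarrow> 'a set option"
  where "valuation V x = (if x = 0 then None
    else Some (Units (ring_on V) #>\<^bsub>mult_of (ring_on (fraction_field V))\<^esub> x))"

definition value_zero :: "'a::field set \<Rightarrow> 'a set option"
  where "value_zero V = Some \<one>\<^bsub>value_group V\<^esub>"

definition value_times :: "'a::field set \<Rightarrow> nat \<Rightarrow> 'a set option \<Rightarrow> 'a set option"
  where "value_times V n \<gamma> = (case \<gamma> of
      None \<Rightarrow> if n = 0 then value_zero V else None
    | Some \<alpha> \<Rightarrow> Some (\<alpha> [^]\<^bsub>value_group V\<^esub> n))"

definition value_less :: "'a::field set \<Rightarrow> 'a set option \<Rightarrow> 'a set option \<Rightarrow> bool"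
  where "value_less V \<gamma> \<delta> \<longleftrightarrow> (case (\<gamma>, \<delta>) of
      (None, _) \<Rightarrow> False
    | (Some \<alpha>, None) \<Rightarrow> True
    | (Some \<alpha>, Some \<beta>) \<Rightarrow> \<alpha> \<noteq> \<beta> \<and> (\<exists>x\<in>\<alpha>. \<exists>y\<in>\<beta>. y / x \<in> V))"

text \<open>
  The facts \<open>valuation_eq_iff\<close>, \<open>value_less_iff\<close>, \<open>value_zero_eq\<close> and \<open>value_times_eq\<close> below express
  the value group, its order and its multiples through divisibility in \<open>V\<close>.
\<close>

lemma is_domainD:
  assumes "is_domain V"
  shows "0 \<in> V" "1 \<in> V" "x \<in> V \<Longrightarrow> y \<in> V \<Longrightarrow> x * y \<in> V"
proof -
  have "subring V ring_of_type_algebra"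
    using assms unfolding subdomain_def subcring_def by blast
  from subringE(2,3,6)[OF this]
  show "0 \<in> V" "1 \<in> V" "x \<in> V \<Longrightarrow> y \<in> V \<Longrightarrow> x * y \<in> V"
    by (auto simp: ring_of_type_algebra_def)
qed

lemma Units_ring_on:
  fixes V :: "'a::field set"
  shows "Units (ring_on V) = {u \<in> V. u \<noteq> 0 \<and> 1 / u \<in> V}"
proof -
  have inv: "u \<noteq> 0 \<and> w = 1 / u" if "u * w = 1" for u w :: 'a
    using that by (metis mult_zero_left nonzero_mult_div_cancel_left zero_neq_one)
  have U: "Units (ring_on V) = {u \<in> V. \<exists>w\<in>V. w * u = 1 \<and> u * w = 1}"
    by (simp add: Units_def ring_of_type_algebra_def)
  show ?thesis
  proof (intro equalityI subsetI)
    fix u assume "u \<in> Units (ring_on V)"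
    then obtain w where "u \<in> V" "w \<in> V" "u * w = 1" unfolding U by blast
    with inv[of u w] show "u \<in> {u \<in> V. u \<noteq> 0 \<and> 1 / u \<in> V}" by simp
  next
    fix u assume u: "u \<in> {u \<in> V. u \<noteq> 0 \<and> 1 / u \<in> V}"
    then have "1 / u * u = 1" "u * (1 / u) = 1" by simp_all
    with u show "u \<in> Units (ring_on V)" unfolding U by blast
  qed
qed

lemma valuation_nonzero:
  assumes "is_domain V" "x \<noteq> 0"
  shows "valuation V x = Some {u * x |u. u \<in> V \<and> u \<noteq> 0 \<and> 1 / u \<in> V}"
proof -
  have "(\<otimes>\<^bsub>mult_of (ring_on (fraction_field V))\<^esub>) = (*)"
    by (simp add: mult_of_def ring_of_type_algebra_def)
  then show ?thesis
    unfolding valuation_def r_coset_def Units_ring_on using assms(2) by auto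
qed

lemma valuation_eq_iff:
  assumes V: "is_domain V" and "x \<noteq> 0" "y \<noteq> 0"
  shows "valuation V x = valuation V y \<longleftrightarrow> x / y \<in> V \<and> y / x \<in> V"
proof
  assume eq: "valuation V x = valuation V y"
  have "x = 1 * x" "y = 1 * y" by simp_all
  then have "x \<in> {u * y |u. u \<in> V \<and> u \<noteq> 0 \<and> 1 / u \<in> V}"
    "y \<in> {u * x |u. u \<in> V \<and> u \<noteq> 0 \<and> 1 / u \<in> V}"
    using eq is_domainD(2)[OF V] assms(2,3) unfolding valuation_nonzero[OF V assms(2)] valuation_nonzero[OF V assms(3)]
    by (smt (verit) mem_Collect_eq option.inject div_by_1 zero_neq_one)+
  then show "x / y \<in> V \<and> y / x \<in> V" using assms by auto
next
  assume r: "x / y \<in> V \<and> y / x \<in> V"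
  have *: "{u * a |u. u \<in> V \<and> u \<noteq> 0 \<and> 1 / u \<in> V} \<subseteq> {u * b |u. u \<in> V \<and> u \<noteq> 0 \<and> 1 / u \<in> V}"
    if ab: "a / b \<in> V" "b / a \<in> V" "a \<noteq> 0" "b \<noteq> 0" for a b
  proof safe
    fix u assume u: "u \<in> V" "u \<noteq> 0" "1 / u \<in> V"
    have "u * (a / b) \<in> V" "(1 / u) * (b / a) \<in> V" using u ab is_domainD(3)[OF V] by blast+
    then show "\<exists>w. u * a = w * b \<and> w \<in> V \<and> w \<noteq> 0 \<and> 1 / w \<in> V"
      using u ab by (intro exI[of _ "u * (a / b)"]) auto
  qed
  show "valuation V x = valuation V y"
    unfolding valuation_nonzero[OF V assms(2)] valuation_nonzero[OF V assms(3)]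
    using *[of x y] *[of y x] r assms(2,3) by blast
qed

lemma value_less_iff:
  assumes V: "is_domain V" and "x \<noteq> 0" "y \<noteq> 0"
  shows "value_less V (valuation V x) (valuation V y) \<longleftrightarrow> y / x \<in> V \<and> x / y \<notin> V"
proof -
  let ?c = "\<lambda>x. {u * x |u. u \<in> V \<and> u \<noteq> 0 \<and> 1 / u \<in> V}"
  have "(\<exists>a\<in>?c x. \<exists>b\<in>?c y. b / a \<in> V) \<longleftrightarrow> y / x \<in> V"
  proof
    assume "\<exists>a\<in>?c x. \<exists>b\<in>?c y. b / a \<in> V"
    then obtain u w where u: "u \<in> V" "u \<noteq> 0" "w \<noteq> 0" "1 / w \<in> V" "(w * y) / (u * x) \<in> V" by blast
    then have "u * (1 / w) * ((w * y) / (u * x)) \<in> V" using is_domainD(3)[OF V] by blast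
    then show "y / x \<in> V" using u by simp
  next
    assume "y / x \<in> V"
    moreover have "x \<in> ?c x" "y \<in> ?c y" using is_domainD(2)[OF V] by force+
    ultimately show "\<exists>a\<in>?c x. \<exists>b\<in>?c y. b / a \<in> V" by blast
  qed
  moreover have "?c x = ?c y \<longleftrightarrow> x / y \<in> V \<and> y / x \<in> V"
    using valuation_eq_iff[OF assms] unfolding valuation_nonzero[OF V assms(2)] valuation_nonzero[OF V assms(3)]
    by simp
  ultimately show ?thesis
    unfolding value_less_def valuation_nonzero[OF V assms(2)] valuation_nonzero[OF V assms(3)]
    by auto
qed

lemma value_zero_eq:
  assumes "is_domain V"
  shows "value_zero V = valuation V 1"
  using assms
  by (auto simp: value_zero_def value_group_def FactGroup_def valuation_nonzero Units_ring_on)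

lemma value_times_eq:
  assumes V: "is_domain V" and "x \<noteq> 0"
  shows "value_times V n (valuation V x) = valuation V (x ^ n)"
proof -
  let ?c = "\<lambda>x. {u * x |u. u \<in> V \<and> u \<noteq> 0 \<and> 1 / u \<in> V}"
  have mult: "?c a \<otimes>\<^bsub>value_group V\<^esub> ?c b = ?c (a * b)" for a b
  proof -
    have "?c a \<otimes>\<^bsub>value_group V\<^esub> ?c b = (\<Union>h\<in>?c a. \<Union>k\<in>?c b. {h * k})"
      by (simp add: value_group_def FactGroup_def set_mult_def mult_of_def ring_of_type_algebra_def)
    also have "\<dots> = ?c (a * b)"
    proof (intro equalityI subsetI)
      fix z assume "z \<in> (\<Union>h\<in>?c a. \<Union>k\<in>?c b. {h * k})"
      then obtain u w where uw: "z = (u * a) * (w * b)" "u \<in> V" "u \<noteq> 0" "1 / u \<in> V"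
        "w \<in> V" "w \<noteq> 0" "1 / w \<in> V" by blast
      then have "u * w \<in> V" "(1 / u) * (1 / w) \<in> V" using is_domainD(3)[OF V] by blast+
      moreover have "z = (u * w) * (a * b)" using uw by simp
      ultimately show "z \<in> ?c (a * b)" using uw by force
    next
      fix z assume "z \<in> ?c (a * b)"
      then obtain u where u: "z = (u * a) * b" "u \<in> V" "u \<noteq> 0" "1 / u \<in> V"
        by (auto simp: mult.assoc)
      moreover have "b \<in> ?c b" using is_domainD(2)[OF V] by force
      ultimately show "z \<in> (\<Union>h\<in>?c a. \<Union>k\<in>?c b. {h * k})" by blast
    qed
    finally show ?thesis .
  qed
  have "?c x [^]\<^bsub>value_group V\<^esub> n = ?c (x ^ n)"
  proof (induction n)
    case 0
    show ?case
      using value_zero_eq[OF V] valuation_nonzero[OF V, of 1] by (simp add: value_zero_def)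
  next
    case (Suc n)
    then show ?case using mult[of "x ^ n" x] by (simp add: mult.commute)
  qed
  then show ?thesis
    using valuation_nonzero[OF V] assms(2) by (simp add: value_times_def)
qed


section \<open>Singular Pruefer domains and pseudosingular GPVDs\<close>

text \<open>
  The intersection of the localizations is taken in the field of fractions of \<open>T\<close>.  As
  \<open>localization_at T m\<close> is local, a maximal ideal of it is the maximal ideal.
\<close>

definition singular :: "'a::field set \<Rightarrow> bool"
  where "singular T \<longleftrightarrow> pruefer_domain T \<and>
    (\<exists>\<Lambda>. (\<forall>m\<in>\<Lambda>. maximalideal m (ring_on T)) \<and>
      T = {x \<in> fraction_field T. \<forall>m\<in>\<Lambda>. x \<in> localization_at T m} \<and>
      (\<exists>\<tau>. (\<forall>m\<in>\<Lambda>. \<tau> m \<in> localization_at T m \<and>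
             maximalideal (cgenideal (ring_on (localization_at T m)) (\<tau> m))
               (ring_on (localization_at T m))) \<and>
        (\<exists>t\<in>T. \<exists>n::nat. \<forall>m\<in>\<Lambda>. let V = localization_at T m in
           value_less V (value_zero V) (valuation V t) \<and>
           value_less V (valuation V t) (value_times V n (valuation V (\<tau> m))))))"

text \<open>
  The associated Pruefer domain of a GPVD is unique, so the quantifier over \<open>T\<close> merely names it.
\<close>

definition pseudosingular_gpvd :: "'a::field set \<Rightarrow> bool"
  where "pseudosingular_gpvd D \<longleftrightarrow>
    gpvd D \<and> (\<forall>T. associated_pruefer_domain D T \<longrightarrow> singular T)"

end

theory Submission
  imports Defs
begin

text \<open>
  Let \<open>t\<close> and \<open>n\<close> be as in the definition of a singular domain.  For \<open>y \<noteq> 0\<close> in \<open>K(x)\<close> the element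
  \<open>u = y\<^sup>n\<^sup>+\<^sup>1 / (t + y\<^sup>n\<^sup>+\<^sup>1)\<close> satisfies \<open>u, u / y, (1 - u) y \<in> Int\<^sup>R(E, T)\<close>: at every valuation with
  \<open>v(y) > 0\<close> the denominator has value \<open>v(t) < n v(y)\<close>, and otherwise its value is \<open>(n + 1) v(y)\<close>.
  This makes \<open>Int\<^sup>R(E, T)\<close> a Pruefer domain.

  The same expression gives uniform quasi-inverses.  Let \<open>J\<close> be the common radical ideal, so that
  \<open>D/J\<close> and \<open>T/J\<close> are von Neumann regular.  For \<open>\<phi> \<in> Int\<^sup>R(E, T)\<close> and
  \<open>\<psi> = \<phi>\<^sup>n / (t + \<phi>\<^sup>n\<^sup>+\<^sup>1)\<close> the function \<open>\<phi> - \<phi>\<^sup>2 \<psi>\<close> takes values in the Jacobson radical of \<open>T\<close>,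
  hence in \<open>J\<close>.  So \<open>Int\<^sup>R(E, T)\<close> and \<open>Int\<^sup>R(E, D)\<close> are von Neumann regular modulo \<open>Int\<^sup>R(E, J)\<close>.  As
  \<open>D \<subseteq> T\<close> is unibranched, the idempotents of \<open>T/J\<close> lie in \<open>D/J\<close>; therefore \<open>\<phi> \<psi> \<in> Int\<^sup>R(E, D)\<close>, and the
  primes above \<open>Int\<^sup>R(E, J)\<close> correspond.  The remaining primes correspond because \<open>Int\<^sup>R(E, J)\<close> is
  a common ideal.
\<close>

section \<open>Subrings of a field and their ideals\<close>

text \<open>Closure is stated with the operations of the field itself, so that ring identities are
  left to the simplifier; the absence of zero divisors is inherited from the field.\<close>

locale domain_set =
  fixes A :: "'a::field set"
  assumes zero_in: "0 \<in> A" and one_in: "1 \<in> A"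
    and uminus_in: "x \<in> A \<Longrightarrow> - x \<in> A"
    and add_in: "x \<in> A \<Longrightarrow> y \<in> A \<Longrightarrow> x + y \<in> A"
    and mult_in: "x \<in> A \<Longrightarrow> y \<in> A \<Longrightarrow> x * y \<in> A"
begin

lemma diff_in: "x \<in> A \<Longrightarrow> y \<in> A \<Longrightarrow> x - y \<in> A"
  using add_in[of x "- y"] uminus_in[of y] by simp

lemma power_in: "x \<in> A \<Longrightarrow> x ^ n \<in> A"
  by (induction n) (auto intro: one_in mult_in)

lemma sum_in: "(\<And>s. s \<in> F \<Longrightarrow> f s \<in> A) \<Longrightarrow> sum f F \<in> A"
  by (induction F rule: infinite_finite_induct) (auto intro: zero_in add_in)

lemmas ring_in = zero_in one_in uminus_in add_in mult_in diff_in power_in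

end

lemma ring_of_type_algebra_simps [simp]:
  "carrier ring_of_type_algebra = (UNIV :: 'a set)"
  "x \<otimes>\<^bsub>ring_of_type_algebra\<^esub> y = x * y" "x \<oplus>\<^bsub>ring_of_type_algebra\<^esub> y = x + y"
  "\<one>\<^bsub>ring_of_type_algebra\<^esub> = 1" "\<zero>\<^bsub>ring_of_type_algebra\<^esub> = 0"
  for x y :: "'a::field"
  by (simp_all add: ring_of_type_algebra_def)

lemma ring_on_power [simp]: "x [^]\<^bsub>ring_on A\<^esub> (n::nat) = x ^ n"
  for A :: "'a::field set"
  by (induction n) (simp_all add: nat_pow_def mult.commute)

lemma domain_set_iff: "is_domain A \<longleftrightarrow> domain_set A"
proof
  interpret F: field "ring_of_type_algebra :: 'a ring" by (rule field_from_type_algebra)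
  have um: "\<ominus>\<^bsub>ring_of_type_algebra\<^esub> x = - x" for x :: 'a
    by (rule F.minus_equality) simp_all
  {
    assume "is_domain A"
    then have s: "subring A ring_of_type_algebra"
      unfolding subdomain_def subcring_def by blast
    show "domain_set A"
      using subringE[OF s] um by unfold_locales auto
  next
    assume "domain_set A"
    then interpret domain_set A .
    have "subcring A (ring_of_type_algebra :: 'a ring)"
      using um ring_in
      by (intro F.subcringI' F.subringI) auto
    then show "is_domain A"
      by (auto simp: subdomain_def subdomain_axioms_def ring_of_type_algebra_def)
  }
qed

lemma (in domain_set) cring_ring_on: "cring (ring_on A)"
proof (rule cringI)
  show "abelian_group (ring_on A)"
  proof (rule abelian_groupI)
    show "\<exists>y\<in>carrier (ring_on A). y \<oplus>\<^bsub>ring_on A\<^esub> x = \<zero>\<^bsub>ring_on A\<^esub>"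
      if "x \<in> carrier (ring_on A)" for x
      using that uminus_in by (intro bexI[of _ "- x"]) simp_all
  qed (simp_all add: ring_in add_ac)
  show "comm_monoid (ring_on A)"
    by (rule comm_monoidI) (simp_all add: ring_in mult_ac)
qed (simp add: distrib_right)

section \<open>Elementwise forms of the ideal notions\<close>

definition ideal_of :: "'a::field set \<Rightarrow> 'a set \<Rightarrow> bool"
  where "ideal_of A I \<longleftrightarrow> I \<subseteq> A \<and> 0 \<in> I \<and> (\<forall>x\<in>I. \<forall>y\<in>I. x + y \<in> I) \<and> (\<forall>a\<in>A. \<forall>x\<in>I. a * x \<in> I)"

definition prime_of :: "'a::field set \<Rightarrow> 'a set \<Rightarrow> bool"
  where "prime_of A P \<longleftrightarrow> ideal_of A P \<and> 1 \<notin> P \<and> (\<forall>a\<in>A. \<forall>b\<in>A. a * b \<in> P \<longrightarrow> a \<in> P \<or> b \<in> P)"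

text \<open>Encoded as "the quotient is a field": inverses modulo \<open>M\<close> are what the
  arguments below produce and consume, without quantifying over other ideals.\<close>

definition maximal_of :: "'a::field set \<Rightarrow> 'a set \<Rightarrow> bool"
  where "maximal_of A M \<longleftrightarrow> ideal_of A M \<and> 1 \<notin> M \<and> (\<forall>c\<in>A. c \<notin> M \<longrightarrow> (\<exists>x\<in>A. 1 - c * x \<in> M))"

definition radical_of :: "'a::field set \<Rightarrow> 'a set \<Rightarrow> bool"
  where "radical_of A I \<longleftrightarrow> ideal_of A I \<and> (\<forall>x\<in>A. \<forall>n. x ^ n \<in> I \<longrightarrow> x \<in> I)"

lemma ideal_ofD:
  assumes "ideal_of A I"
  shows "x \<in> I \<Longrightarrow> x \<in> A" "0 \<in> I" "x \<in> I \<Longrightarrow> y \<in> I \<Longrightarrow> x + y \<in> I"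
    "a \<in> A \<Longrightarrow> x \<in> I \<Longrightarrow> a * x \<in> I" "a \<in> A \<Longrightarrow> x \<in> I \<Longrightarrow> x * a \<in> I"
  using assms unfolding ideal_of_def by (auto simp: mult.commute)

lemma prime_ofD:
  assumes "prime_of A P"
  shows "ideal_of A P" "1 \<notin> P" "a \<in> A \<Longrightarrow> b \<in> A \<Longrightarrow> a * b \<in> P \<Longrightarrow> a \<in> P \<or> b \<in> P"
  using assms unfolding prime_of_def by auto

lemma radical_ofD:
  assumes "radical_of A I"
  shows "ideal_of A I" "x \<in> A \<Longrightarrow> x ^ n \<in> I \<Longrightarrow> x \<in> I"
  using assms unfolding radical_of_def by auto

context domain_set
begin

lemma ideal_of_uminus: "ideal_of A I \<Longrightarrow> x \<in> I \<Longrightarrow> - x \<in> I"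
  using ideal_ofD(4)[of A I "- 1" x] uminus_in[OF one_in] by simp

lemma ideal_of_diff: "ideal_of A I \<Longrightarrow> x \<in> I \<Longrightarrow> y \<in> I \<Longrightarrow> x - y \<in> I"
  using ideal_ofD(3)[of A I x "- y"] ideal_of_uminus by simp

lemma ideal_of_one: "ideal_of A I \<Longrightarrow> 1 \<in> I \<longleftrightarrow> I = A"
  using ideal_ofD(1)[of A I] ideal_ofD(4)[of A I _ 1] one_in by auto

lemma ideal_iff: "ideal I (ring_on A) \<longleftrightarrow> ideal_of A I"
proof
  assume "ideal I (ring_on A)"
  then interpret ideal I "ring_on A" .
  show "ideal_of A I"
    using a_subset additive_subgroup.zero_closed[OF is_additive_subgroup]
      additive_subgroup.a_closed[OF is_additive_subgroup] I_l_closed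
    unfolding ideal_of_def by simp
next
  interpret R: cring "ring_on A" by (rule cring_ring_on)
  assume I: "ideal_of A I"
  show "ideal I (ring_on A)"
  proof (rule idealI[OF R.ring_axioms])
    show "subgroup I (add_monoid (ring_on A))"
    proof (rule group.subgroupI[OF R.a_group])
      fix a assume a: "a \<in> I"
      have "\<ominus>\<^bsub>ring_on A\<^esub> a = - a"
        by (rule R.minus_equality) (simp_all add: a ideal_ofD(1)[OF I] uminus_in)
      then show "inv\<^bsub>add_monoid (ring_on A)\<^esub> a \<in> I"
        using ideal_of_uminus[OF I a] by (simp add: a_inv_def)
    next
      show "I \<noteq> {}" using ideal_ofD(2)[OF I] by blast
    qed (simp_all add: ideal_ofD[OF I] subsetI)
  qed (simp_all add: ideal_ofD[OF I])
qed

lemma primeideal_iff: "primeideal P (ring_on A) \<longleftrightarrow> prime_of A P"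
  using ideal_of_one[of P] cring_ring_on
  unfolding primeideal_def primeideal_axioms_def prime_of_def ideal_iff by auto

lemma cgenideal_eq: "cgenideal (ring_on A) c = {x * c |x. x \<in> A}"
  by (simp add: cgenideal_def)

lemma ideal_of_sum:
  assumes I: "ideal_of A I" and K: "ideal_of A K"
  shows "ideal_of A {x + y |x y. x \<in> I \<and> y \<in> K}" (is "ideal_of A ?J")
  unfolding ideal_of_def
proof (intro conjI ballI)
  show "?J \<subseteq> A" using ideal_ofD(1)[OF I] ideal_ofD(1)[OF K] add_in by blast
  show "0 \<in> ?J" using ideal_ofD(2)[OF I] ideal_ofD(2)[OF K] by force
next
  fix u v assume "u \<in> ?J" "v \<in> ?J"
  then obtain x y x' y' where *: "u = x + y" "v = x' + y'" "x \<in> I" "x' \<in> I" "y \<in> K" "y' \<in> K"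
    by blast
  have "u + v = (x + x') + (y + y')" using * by simp
  moreover have "x + x' \<in> I" "y + y' \<in> K" using * ideal_ofD(3)[OF I] ideal_ofD(3)[OF K] by auto
  ultimately show "u + v \<in> ?J" by blast
next
  fix a u assume "a \<in> A" "u \<in> ?J"
  then obtain x y where *: "u = x + y" "x \<in> I" "y \<in> K" by blast
  have "a * u = a * x + a * y" using * by (simp add: distrib_left)
  moreover have "a * x \<in> I" "a * y \<in> K"
    using * \<open>a \<in> A\<close> ideal_ofD(4)[OF I] ideal_ofD(4)[OF K] by auto
  ultimately show "a * u \<in> ?J" by blast
qed

text \<open>This is \<open>I + c A\<close>, the ideal against which maximality is tested, both for
  maximal ideals and in Krull's argument.\<close>

lemma ideal_of_adjoin:
  assumes "ideal_of A I" "c \<in> A"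
  shows "ideal_of A {y + c * x |x y. x \<in> A \<and> y \<in> I}"
proof -
  have "ideal_of A {x * c |x. x \<in> A}"
    using cring.cgenideal_ideal[OF cring_ring_on, of c] assms(2) by (simp add: ideal_iff cgenideal_eq)
  from ideal_of_sum[OF assms(1) this]
  have "ideal_of A {y + z |y z. y \<in> I \<and> z \<in> {x * c |x. x \<in> A}}" .
  moreover have "{y + z |y z. y \<in> I \<and> z \<in> {x * c |x. x \<in> A}} = {y + c * x |x y. x \<in> A \<and> y \<in> I}"
    by (auto simp: mult.commute)
  ultimately show ?thesis by simp
qed

lemma maximalideal_iff: "maximalideal M (ring_on A) \<longleftrightarrow> maximal_of A M"
proof
  assume "maximalideal M (ring_on A)"
  then have M: "ideal_of A M" "M \<noteq> A"
    and max: "\<And>J. ideal_of A J \<Longrightarrow> M \<subseteq> J \<Longrightarrow> J = M \<or> J = A"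
    unfolding maximalideal_def maximalideal_axioms_def ideal_iff by (auto simp: ideal_of_def)
  have "\<exists>x\<in>A. 1 - c * x \<in> M" if c: "c \<in> A" "c \<notin> M" for c
  proof -
    let ?J = "{y + c * x |x y. x \<in> A \<and> y \<in> M}"
    have "M \<subseteq> ?J" using zero_in by force
    moreover have "c \<in> ?J" using one_in ideal_ofD(2)[OF M(1)] by force
    ultimately have "1 \<in> ?J" using max[OF ideal_of_adjoin[OF M(1) c(1)]] c(2) one_in by blast
    then obtain x y where xy: "1 = y + c * x" "x \<in> A" "y \<in> M" by blast
    then have "1 - c * x = y" by (metis add_diff_cancel_right')
    with xy show ?thesis by auto
  qed
  then show "maximal_of A M" using M ideal_of_one unfolding maximal_of_def by blast
next
  assume M: "maximal_of A M"
  have "J = M \<or> J = A" if J: "ideal_of A J" "M \<subseteq> J" for J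
  proof (rule ccontr)
    assume n: "\<not> (J = M \<or> J = A)"
    then obtain c where c: "c \<in> J" "c \<notin> M" using J by blast
    then obtain x where x: "x \<in> A" "1 - c * x \<in> M"
      using M ideal_ofD(1)[OF J(1)] unfolding maximal_of_def by blast
    have "(1 - c * x) + c * x \<in> J" using ideal_ofD(3,5)[OF J(1)] x c J(2) by blast
    then have "1 \<in> J" by simp
    then show False using n ideal_of_one[OF J(1)] by blast
  qed
  then show "maximalideal M (ring_on A)"
    using M ideal_of_one[of M]
    unfolding maximalideal_def maximalideal_axioms_def maximal_of_def ideal_iff by auto
qed

lemma maximal_of_prime:
  assumes "maximal_of A M"
  shows "prime_of A M"
  using cring.maximalideal_prime[OF cring_ring_on] assms
  unfolding maximalideal_iff primeideal_iff by blast

lemma radical_ideal_iff: "radical_ideal I (ring_on A) \<longleftrightarrow> radical_of A I"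
proof -
  have "x \<in> I \<Longrightarrow> \<exists>n. x ^ n \<in> I" for x by (rule exI[of _ 1]) simp
  then have "I \<subseteq> A \<Longrightarrow> {x \<in> A. \<exists>n. x ^ n \<in> I} = I \<longleftrightarrow> (\<forall>x\<in>A. \<forall>n. x ^ n \<in> I \<longrightarrow> x \<in> I)"
    by blast
  then show ?thesis
    unfolding radical_ideal_def radical_of_def ideal_iff ideal_of_def by (simp cong: conj_cong)
qed

lemma genideal_least:
  "Z \<subseteq> A \<Longrightarrow> ideal_of A (genideal (ring_on A) Z)"
  "Z \<subseteq> A \<Longrightarrow> Z \<subseteq> genideal (ring_on A) Z"
  "ideal_of A I \<Longrightarrow> Z \<subseteq> I \<Longrightarrow> genideal (ring_on A) Z \<subseteq> I"
  using ring.genideal_ideal[OF cring.axioms(1)[OF cring_ring_on], of Z]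
    ring.genideal_self[OF cring.axioms(1)[OF cring_ring_on], of Z]
    ring.genideal_minimal[OF cring.axioms(1)[OF cring_ring_on], of I Z]
  by (simp_all add: ideal_iff)

end

lemma ideal_of_contract:
  assumes "domain_set A" "A \<subseteq> B" "ideal_of B I"
  shows "ideal_of A (I \<inter> A)"
  using ideal_ofD(2-4)[OF assms(3)] domain_set.ring_in[OF assms(1)] assms(2)
  unfolding ideal_of_def by auto

lemma prime_of_contract:
  assumes "domain_set A" "A \<subseteq> B" "prime_of B Q"
  shows "prime_of A (Q \<inter> A)"
  using prime_ofD(2,3)[OF assms(3)] assms(2) ideal_of_contract[OF assms(1,2) prime_ofD(1)[OF assms(3)]]
  unfolding prime_of_def by auto

lemma (in domain_set) maximal_of_eqI:
  assumes "maximal_of A M" "prime_of A P" "M \<subseteq> P"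
  shows "P = M"
proof (rule ccontr)
  assume "P \<noteq> M"
  then obtain c where c: "c \<in> P" "c \<notin> M" using assms(3) by blast
  have P: "ideal_of A P" using prime_ofD(1)[OF assms(2)] .
  obtain x where x: "x \<in> A" "1 - c * x \<in> P"
    using c assms(1,3) ideal_ofD(1)[OF P] unfolding maximal_of_def by blast
  then have "(1 - c * x) + c * x \<in> P" using ideal_ofD(3,5)[OF P] c by blast
  then show False using prime_ofD(2)[OF assms(2)] by simp
qed

text \<open>Krull: an ideal that is maximal among those disjoint from a multiplicative set is prime.\<close>

lemma (in domain_set) exists_prime_of:
  assumes I: "ideal_of A I" and W: "W \<subseteq> A" "1 \<in> W" "\<And>x y. x \<in> W \<Longrightarrow> y \<in> W \<Longrightarrow> x * y \<in> W"
    and disj: "I \<inter> W = {}"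
  obtains P where "prime_of A P" "I \<subseteq> P" "P \<inter> W = {}"
proof -
  let ?F = "{J. ideal_of A J \<and> I \<subseteq> J \<and> J \<inter> W = {}}"
  have "\<exists>M\<in>?F. \<forall>Z\<in>?F. M \<subseteq> Z \<longrightarrow> Z = M"
  proof (rule subset_Zorn_nonempty)
    show "?F \<noteq> {}" using I disj by blast
    fix \<C> assume ne: "\<C> \<noteq> {}" and ch: "subset.chain ?F \<C>"
    then have sub: "\<C> \<subseteq> ?F" and tot: "\<And>Z Y. Z \<in> \<C> \<Longrightarrow> Y \<in> \<C> \<Longrightarrow> Z \<subseteq> Y \<or> Y \<subseteq> Z"
      by (auto simp: subset_chain_def)
    have "ideal_of A (\<Union>\<C>)"
      unfolding ideal_of_def
    proof (intro conjI ballI)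
      show "\<Union>\<C> \<subseteq> A" "0 \<in> \<Union>\<C>" using sub ne by (auto simp: ideal_of_def)
      fix x y assume "x \<in> \<Union>\<C>" "y \<in> \<Union>\<C>"
      then obtain Z where "Z \<in> \<C>" "x \<in> Z" "y \<in> Z" using tot by blast
      then show "x + y \<in> \<Union>\<C>" using sub ideal_ofD(3)[of A Z] by blast
    next
      fix a x assume "a \<in> A" "x \<in> \<Union>\<C>"
      then show "a * x \<in> \<Union>\<C>" using sub ideal_ofD(4)[of A] by blast
    qed
    then show "\<Union>\<C> \<in> ?F" using sub ne by blast
  qed
  then obtain P where P: "ideal_of A P" "I \<subseteq> P" "P \<inter> W = {}"
    and max: "\<And>Z. ideal_of A Z \<Longrightarrow> P \<subseteq> Z \<Longrightarrow> Z \<inter> W = {} \<Longrightarrow> Z = P"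
    by (smt (verit, best) mem_Collect_eq order_trans)
  \<comment> \<open>By maximality \<open>P + c A\<close> meets \<open>W\<close>: modulo
    \<open>P\<close>, some \<open>w\<close> in \<open>W\<close> is a multiple of
    \<open>c\<close>.\<close>
  have meet: "\<exists>w\<in>W. \<exists>x\<in>A. w - c * x \<in> P" if c: "c \<in> A" "c \<notin> P" for c
  proof -
    let ?J = "{y + c * x |x y. x \<in> A \<and> y \<in> P}"
    have "P \<subseteq> ?J" using zero_in by force
    moreover have "c \<in> ?J" using one_in ideal_ofD(2)[OF P(1)] by force
    ultimately have "?J \<inter> W \<noteq> {}" using max[OF ideal_of_adjoin[OF P(1) c(1)]] c(2) by blast
    then obtain x y where xy: "y + c * x \<in> W" "x \<in> A" "y \<in> P" by blast
    then show ?thesis by (intro bexI[of _ "y + c * x"] bexI[of _ x]) auto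
  qed
  have "a \<in> P \<or> b \<in> P" if ab: "a \<in> A" "b \<in> A" "a * b \<in> P" for a b
  proof (rule ccontr)
    assume "\<not> (a \<in> P \<or> b \<in> P)"
    then obtain w x w' x' where *: "w \<in> W" "x \<in> A" "w - a * x \<in> P" "w' \<in> W" "x' \<in> A" "w' - b * x' \<in> P"
      using meet[OF ab(1)] meet[OF ab(2)] by blast
    \<comment> \<open>Modulo \<open>P\<close>, \<open>w = a x\<close> and \<open>w' = b x'\<close>,
      so \<open>w w'\<close> is a multiple of \<open>a b\<close>; the sum is an explicit certificate
      for \<open>w * w' \<in> P\<close>.\<close>
    have "w' * (w - a * x) + (a * x) * (w' - b * x') + (x * x') * (a * b) \<in> P"
    proof (intro ideal_ofD(3)[OF P(1)])
      show "w' * (w - a * x) \<in> P" "(a * x) * (w' - b * x') \<in> P" "(x * x') * (a * b) \<in> P"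
        using * ab W(1) mult_in by (blast intro: ideal_ofD(4)[OF P(1)])+
    qed
    moreover have "w' * (w - a * x) + (a * x) * (w' - b * x') + (x * x') * (a * b) = w * w'"
      by (simp add: algebra_simps)
    ultimately show False using W(3)[OF *(1,4)] P(3) by auto
  qed
  then have "prime_of A P" using P W(2) unfolding prime_of_def by blast
  then show ?thesis using P that by blast
qed

section \<open>Rings that are von Neumann regular modulo an ideal\<close>

text \<open>
  A reduced ring of Krull dimension zero is von Neumann regular: the multiplicative set of all
  \<open>c\<^sup>k (1 - c x)\<close> meets \<open>J\<close>, since a prime above \<open>J\<close> avoiding it would be maximal.
\<close>

lemma (in domain_set) regular_mod_radical:
  assumes J: "radical_of A J" and max: "\<And>P. prime_of A P \<Longrightarrow> J \<subseteq> P \<Longrightarrow> maximal_of A P"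
    and c: "c \<in> A"
  obtains d where "d \<in> A" "c - c\<^sup>2 * d \<in> J"
proof -
  let ?W = "{c ^ k * (1 - c * x) |k x. x \<in> A}"
  note JD = ideal_ofD[OF radical_ofD(1)[OF J]]
  have "J \<inter> ?W \<noteq> {}"
  proof
    assume disj: "J \<inter> ?W = {}"
    obtain P where P: "prime_of A P" "J \<subseteq> P" "P \<inter> ?W = {}"
    proof (rule exists_prime_of[of J ?W])
      show "ideal_of A J" by (rule radical_ofD(1)[OF J])
      show "?W \<subseteq> A" using c ring_in by auto
      have "1 = c ^ 0 * (1 - c * 0)" by simp
      then show "1 \<in> ?W" using zero_in by blast
      fix u v assume "u \<in> ?W" "v \<in> ?W"
      then obtain k x l y where *: "u = c ^ k * (1 - c * x)" "v = c ^ l * (1 - c * y)" "x \<in> A" "y \<in> A"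
        by blast
      have "u * v = c ^ (k + l) * (1 - c * (x + y - c * x * y))"
        unfolding *(1,2) by (simp add: power_add algebra_simps)
      moreover have "x + y - c * x * y \<in> A" using * c ring_in by simp
      ultimately show "u * v \<in> ?W" by blast
    qed (use disj in auto)
    \<comment> \<open>The choice \<open>k = 1\<close>, \<open>x = 0\<close> puts \<open>c\<close>
      into \<open>?W\<close>, so \<open>c\<close> avoids \<open>P\<close> and has an inverse
      \<open>x\<close> modulo \<open>P\<close>; but \<open>k = 0\<close> puts
      \<open>1 - c * x\<close> into \<open>?W\<close> as well.\<close>
    have "c \<notin> P"
    proof
      assume "c \<in> P"
      moreover have "c = c ^ 1 * (1 - c * 0)" by simp
      then have "c \<in> ?W" using zero_in by blast
      ultimately show False using P(3) by blast
    qed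
    then obtain x where x: "x \<in> A" "1 - c * x \<in> P"
      using max[OF P(1,2)] c unfolding maximal_of_def by blast
    moreover have "1 - c * x = c ^ 0 * (1 - c * x)" by simp
    then have "1 - c * x \<in> ?W" using x(1) by blast
    ultimately show False using P(3) by blast
  qed
  then obtain k x where x: "x \<in> A" "c ^ k * (1 - c * x) \<in> J" by blast
  \<comment> \<open>The exponent \<open>Suc k\<close> supplies both \<open>c ^ k\<close> and a
    factor \<open>1 - c * x\<close>, also when \<open>k = 0\<close>; radicality then removes
    it.\<close>
  let ?b = "c * (1 - c * x)"
  have "?b ^ Suc k = (c * (1 - c * x) ^ k * (1 - 0)) * (c ^ k * (1 - c * x))"
    by (simp add: power_mult_distrib)
  also have "\<dots> \<in> J" by (rule JD(4)) (use x c ring_in in auto)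
  finally have "?b ^ Suc k \<in> J" .
  moreover have "?b \<in> A" using x c ring_in by auto
  ultimately have "?b \<in> J" using radical_ofD(2)[OF J] by blast
  moreover have "?b = c - c\<^sup>2 * x" by (simp add: power2_eq_square algebra_simps)
  ultimately show ?thesis using that x by metis
qed

text \<open>
  The ideal \<open>eT \<inter> D + (1 - e)T \<inter> D\<close> is all of \<open>D\<close>, for a prime of \<open>D\<close> containing it
  would lie below two primes of \<open>T\<close>, one containing \<open>e\<close> and the other \<open>1 - e\<close>.
\<close>

lemma idempotent_descends:
  assumes D: "domain_set D" and T: "domain_set T" and DT: "D \<subseteq> T"
    and inj: "\<And>P Q. prime_of T P \<Longrightarrow> prime_of T Q \<Longrightarrow> P \<inter> D = Q \<inter> D \<Longrightarrow> P = Q"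
    and JD: "ideal_of D J" and JT: "ideal_of T J"
    and max: "\<And>P. prime_of D P \<Longrightarrow> J \<subseteq> P \<Longrightarrow> maximal_of D P"
    and e: "e \<in> T" "e * (1 - e) \<in> J"
  shows "e \<in> D"
proof -
  interpret D: domain_set D by fact
  interpret T: domain_set T by fact
  \<comment> \<open>The colon ideal (J : f). As \<open>e\<close> is idempotent modulo
    \<open>J\<close>, \<open>K e\<close> is \<open>J + (1 - e) T\<close> and
    \<open>K (1 - e)\<close> is \<open>J + e T\<close>.\<close>
  define K where "K f = {x \<in> T. x * f \<in> J}" for f
  have K: "ideal_of T (K f)" if "f \<in> T" for f
    using that ideal_ofD[OF JT] T.ring_in unfolding ideal_of_def K_def by (auto simp: algebra_simps)
  have JK: "J \<subseteq> K f" if "f \<in> T" for f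
    using that ideal_ofD[OF JT] unfolding K_def by auto
  have e1: "1 - e \<in> T" using e T.ring_in by auto
  define I where "I = {x + y |x y. x \<in> K e \<inter> D \<and> y \<in> K (1 - e) \<inter> D}"
  have I: "ideal_of D I"
    unfolding I_def
    by (rule D.ideal_of_sum[OF ideal_of_contract[OF D DT K[OF e(1)]] ideal_of_contract[OF D DT K[OF e1]]])
  have "1 \<in> I"
  proof (rule ccontr)
    assume "1 \<notin> I"
    then obtain P where P: "prime_of D P" "I \<subseteq> P"
      using D.exists_prime_of[OF I, of "{1}"] D.one_in by auto
    have W: "D - P \<subseteq> T" "1 \<in> D - P" using DT prime_ofD(2)[OF P(1)] D.one_in by auto
    have W': "x * y \<in> D - P" if "x \<in> D - P" "y \<in> D - P" for x y
      using that prime_ofD(3)[OF P(1)] D.mult_in by auto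
    \<comment> \<open>A prime of \<open>T\<close> over \<open>K f\<close> that avoids
      \<open>D - P\<close> contracts into \<open>P\<close>; the contraction contains
      \<open>J\<close>, so it is maximal and equals \<open>P\<close>.\<close>
    have above: "\<exists>Q. prime_of T Q \<and> K f \<subseteq> Q \<and> Q \<inter> D = P"
      if f: "f \<in> T" "K f \<inter> D \<subseteq> P" for f
    proof -
      obtain Q where Q: "prime_of T Q" "K f \<subseteq> Q" "Q \<inter> (D - P) = {}"
        using T.exists_prime_of[OF K[OF f(1)] W W'] f by blast
      have "prime_of D (Q \<inter> D)" by (rule prime_of_contract[OF D DT Q(1)])
      moreover have "J \<subseteq> Q \<inter> D" using JK[OF f(1)] Q ideal_ofD(1)[OF JD] by blast
      ultimately have "P = Q \<inter> D"
        using D.maximal_of_eqI[OF max P(1)] Q(3) by blast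
      then show ?thesis using Q by blast
    qed
    have "x \<in> I" if "x \<in> K e \<inter> D" for x
      using that ideal_ofD(2)[OF K[OF e1]] D.zero_in unfolding I_def by force
    moreover have "y \<in> I" if "y \<in> K (1 - e) \<inter> D" for y
      using that ideal_ofD(2)[OF K[OF e(1)]] D.zero_in unfolding I_def by force
    ultimately have "K e \<inter> D \<subseteq> P" "K (1 - e) \<inter> D \<subseteq> P" using P(2) by auto
    then obtain Q Q' where Q: "prime_of T Q" "K e \<subseteq> Q" "Q \<inter> D = P"
      "prime_of T Q'" "K (1 - e) \<subseteq> Q'" "Q' \<inter> D = P"
      using above[OF e(1)] above[OF e1] by metis
    then have "Q = Q'" using inj by metis
    moreover have "1 - e \<in> K e" "e \<in> K (1 - e)" using e e1 by (auto simp: K_def mult.commute)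
    ultimately have "(1 - e) + e \<in> Q" using Q ideal_ofD(3)[OF prime_ofD(1)[OF Q(1)]] by blast
    then show False using prime_ofD(2)[OF Q(1)] by simp
  qed
  then obtain x y where xy: "1 = x + y" "x * e \<in> J" "y * (1 - e) \<in> J" "x \<in> D" "y \<in> D"
    unfolding I_def K_def by blast
  \<comment> \<open>Modulo \<open>J\<close>, \<open>x e = 0\<close> and \<open>y e = y\<close>,
    hence \<open>e = (x + y) e = y\<close>; so \<open>e\<close> differs from an element of
    \<open>D\<close> by one of \<open>J\<close>, and \<open>J\<close> lies in
    \<open>D\<close>.\<close>
  then have "x * e - y * (1 - e) \<in> D"
    using ideal_ofD(1)[OF JD] D.diff_in by blast
  moreover have "x * e - y * (1 - e) = (x + y) * e - y" by (simp add: algebra_simps)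
  then have "x * e - y * (1 - e) = e - y" using xy(1) by simp
  ultimately have "(e - y) + y \<in> D" using D.add_in[OF _ xy(5)] by metis
  then show ?thesis by simp
qed

text \<open>
  Modulo \<open>J\<close>, both \<open>\<psi>\<close> and \<open>d\<^sup>2 c\<close> are the quasi-inverse of \<open>c\<close>, which is unique.
\<close>

lemma quasi_inverse_descends:
  assumes D: "domain_set D" and T: "domain_set T" and DT: "D \<subseteq> T"
    and JD: "ideal_of D J" and JT: "ideal_of T J"
    and c: "c \<in> D" "d \<in> D" "c - c\<^sup>2 * d \<in> J"
    and \<psi>: "\<psi> \<in> T" "c - c\<^sup>2 * \<psi> \<in> J" "\<psi> - \<psi>\<^sup>2 * c \<in> J"
  shows "\<psi> \<in> D"
proof -
  interpret D: domain_set D by fact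
  interpret T: domain_set T by fact
  have "c \<in> T" "d \<in> T" using c DT by auto
  then have "\<psi>\<^sup>2 * (c * d + 1) \<in> T" "d\<^sup>2 * (1 + \<psi> * c) \<in> T"
    using \<psi>(1) by (simp_all add: T.ring_in)
  then have "\<psi>\<^sup>2 * (c * d + 1) * (c - c\<^sup>2 * d) \<in> J" "d\<^sup>2 * (1 + \<psi> * c) * (c - c\<^sup>2 * \<psi>) \<in> J"
    using c(3) \<psi>(2) by (simp_all add: ideal_ofD(4)[OF JT])
  \<comment> \<open>Modulo \<open>J\<close>, both \<open>\<psi>\<close> and
    \<open>d\<^sup>2 * c\<close> equal \<open>\<psi>\<^sup>2 * c ^ 3 * d\<^sup>2\<close>; the
    combination subtracts these two congruences.\<close>
  then have "(\<psi> - \<psi>\<^sup>2 * c) + (\<psi>\<^sup>2 * (c * d + 1)) * (c - c\<^sup>2 * d)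
      - (d\<^sup>2 * (1 + \<psi> * c)) * (c - c\<^sup>2 * \<psi>) \<in> J"
    using \<psi>(3) by (intro T.ideal_of_diff[OF JT ideal_ofD(3)[OF JT]])
  moreover have "(\<psi> - \<psi>\<^sup>2 * c) + (\<psi>\<^sup>2 * (c * d + 1)) * (c - c\<^sup>2 * d)
      - (d\<^sup>2 * (1 + \<psi> * c)) * (c - c\<^sup>2 * \<psi>) = \<psi> - d\<^sup>2 * c"
    by (simp add: power2_eq_square algebra_simps)
  ultimately have "\<psi> - d\<^sup>2 * c \<in> D" using ideal_ofD(1)[OF JD] by metis
  moreover have "d\<^sup>2 * c \<in> D" using c(1,2) by (simp add: D.ring_in)
  ultimately have "(\<psi> - d\<^sup>2 * c) + d\<^sup>2 * c \<in> D" by (rule D.add_in)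
  then show ?thesis by simp
qed

definition unibranched_of :: "'a::field set \<Rightarrow> 'a set \<Rightarrow> bool"
  where "unibranched_of A B \<longleftrightarrow> bij_betw (\<lambda>Q. Q \<inter> A) {Q. prime_of B Q} {P. prime_of A P}"

text \<open>From \<open>c * (1 - c * d) \<in> P\<close> and \<open>c \<notin> P\<close>, primality
  makes \<open>d\<close> an inverse of \<open>c\<close> modulo \<open>P\<close>.\<close>

lemma maximal_of_regular:
  assumes A: "domain_set A" and P: "prime_of A P" "J \<subseteq> P"
    and reg: "\<And>c. c \<in> A \<Longrightarrow> \<exists>d\<in>A. c - c\<^sup>2 * d \<in> J"
  shows "maximal_of A P"
proof -
  interpret A: domain_set A by fact
  have "\<exists>x\<in>A. 1 - c * x \<in> P" if c: "c \<in> A" "c \<notin> P" for c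
  proof -
    obtain d where d: "d \<in> A" "c - c\<^sup>2 * d \<in> P" using reg[OF c(1)] P(2) by blast
    then have "c * (1 - c * d) \<in> P" using d by (simp add: power2_eq_square algebra_simps)
    moreover have "1 - c * d \<in> A" using c d by (simp add: A.ring_in)
    ultimately show ?thesis using prime_ofD(3)[OF P(1) c(1)] c d by blast
  qed
  then show ?thesis using prime_ofD[OF P(1)] unfolding maximal_of_def by blast
qed

text \<open>
  Away from the common ideal \<open>J\<close> the spectra agree, the inverse of contraction being
  \<open>P \<mapsto> {s. s J \<subseteq> P}\<close>.  Above \<open>J\<close> a prime is determined by its idempotents modulo \<open>J\<close>, and
  these lie in \<open>R\<close> by hypothesis.
\<close>

lemma unibranched_of_common_ideal:
  assumes R: "domain_set R" and S: "domain_set S" and RS: "R \<subseteq> S"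
    and JR: "ideal_of R J" and JS: "ideal_of S J"
    and reg: "\<And>c. c \<in> S \<Longrightarrow> \<exists>d\<in>S. c - c\<^sup>2 * d \<in> J \<and> c * d \<in> R \<and> (c \<in> R \<longrightarrow> d \<in> R)"
  shows "unibranched_of R S"
  unfolding unibranched_of_def
proof (rule bij_betwI')
  interpret R: domain_set R by fact
  interpret S: domain_set S by fact
  note JSD = ideal_ofD[OF JS] and JRD = ideal_ofD[OF JR]
  have sub: "Q \<subseteq> Q'"
    if Q: "prime_of S Q" and Q': "prime_of S Q'" and eq: "Q \<inter> R = Q' \<inter> R" for Q Q'
  proof
    note QD = ideal_ofD[OF prime_ofD(1)[OF Q]] and QD' = ideal_ofD[OF prime_ofD(1)[OF Q']]
    fix s assume s: "s \<in> Q"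
    show "s \<in> Q'"
    proof (cases "J \<subseteq> Q'")
      case True
      \<comment> \<open>Modulo \<open>J\<close>, \<open>s\<close> is a multiple of
        \<open>s * d\<close>, which lies in \<open>R\<close>, where the two primes agree.\<close>
      obtain d where d: "d \<in> S" "s - s\<^sup>2 * d \<in> J" "s * d \<in> R" using reg[OF QD(1)[OF s]] by blast
      then have "s * d \<in> Q'" using QD(5) s eq by blast
      then have "s * (s * d) + (s - s\<^sup>2 * d) \<in> Q'" using QD'(3,4) d True QD(1)[OF s] by blast
      then show ?thesis by (simp add: power2_eq_square algebra_simps)
    next
      case False
      \<comment> \<open>Multiplication by \<open>j\<close> moves \<open>s\<close> into
        \<open>J\<close>, hence into \<open>R\<close>, and can be cancelled modulo
        \<open>Q'\<close>.\<close>
      then obtain j where j: "j \<in> J" "j \<notin> Q'" by blast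
      then have "s * j \<in> Q \<inter> R" using s QD(1,5) JSD(1,4) JRD(1) by blast
      then show ?thesis using eq prime_ofD(3)[OF Q'] QD(1) s j JSD(1) by blast
    qed
  qed
  show "(Q \<inter> R = Q' \<inter> R) = (Q = Q')" if "Q \<in> {Q. prime_of S Q}" "Q' \<in> {Q. prime_of S Q}" for Q Q'
    using sub[of Q Q'] sub[of Q' Q] that by auto
  show "Q \<inter> R \<in> {P. prime_of R P}" if "Q \<in> {Q. prime_of S Q}" for Q
    using prime_of_contract[OF R RS] that by auto
  fix P assume "P \<in> {P. prime_of R P}"
  then have P: "prime_of R P" by simp
  note PD = ideal_ofD[OF prime_ofD(1)[OF P]]
  show "\<exists>Q\<in>{Q. prime_of S Q}. P = Q \<inter> R"
  proof (cases "J \<subseteq> P")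
    case False
    then obtain j where j: "j \<in> J" "j \<notin> P" by blast
    let ?Q = "{s \<in> S. \<forall>i\<in>J. s * i \<in> P}"
    have "ideal_of S ?Q"
      unfolding ideal_of_def
    proof (intro conjI ballI)
      show "?Q \<subseteq> S" "0 \<in> ?Q" using PD(2) S.zero_in by auto
      show "x + y \<in> ?Q" if "x \<in> ?Q" "y \<in> ?Q" for x y
        using that PD(3) S.add_in by (auto simp: algebra_simps)
      show "a * x \<in> ?Q" if "a \<in> S" "x \<in> ?Q" for a x
      proof -
        have "x * (a * i) \<in> P" if "i \<in> J" for i
          using \<open>x \<in> ?Q\<close> \<open>a \<in> S\<close> that JSD(4) by blast
        then show ?thesis using that S.mult_in by (auto simp: mult.left_commute mult.assoc)
      qed
    qed
    moreover have "1 \<notin> ?Q" using j by auto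
    moreover have "a \<in> ?Q \<or> b \<in> ?Q" if ab: "a \<in> S" "b \<in> S" "a * b \<in> ?Q" for a b
    proof (rule ccontr)
      assume "\<not> (a \<in> ?Q \<or> b \<in> ?Q)"
      then obtain i i' where i: "i \<in> J" "i' \<in> J" "a * i \<notin> P" "b * i' \<notin> P" using ab by blast
      have "(a * b) * (i * i') \<in> P" using ab i JSD(1,4) by blast
      then have "(a * i) * (b * i') \<in> P" by (simp add: algebra_simps)
      moreover have "a * i \<in> R" "b * i' \<in> R" using i ab JSD(4) JRD(1) by blast+
      ultimately show False using prime_ofD(3)[OF P] i by blast
    qed
    ultimately have "prime_of S ?Q" unfolding prime_of_def by blast
    moreover have "P = ?Q \<inter> R"
    proof (intro equalityI subsetI)
      fix x assume x: "x \<in> P"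
      then show "x \<in> ?Q \<inter> R" using PD(1,5) RS JRD(1) by blast
    next
      fix x assume "x \<in> ?Q \<inter> R"
      then show "x \<in> P" using j prime_ofD(3)[OF P, of x j] JRD(1) by blast
    qed
    ultimately show ?thesis by blast
  next
    case True
    \<comment> \<open>This is the extension \<open>P S\<close>: by regularity a single
      \<open>e\<close> in \<open>P\<close> with \<open>s = s e\<close> modulo \<open>J\<close>
      suffices for each element.\<close>
    let ?Q = "{s \<in> S. \<exists>e\<in>P. s * (1 - e) \<in> J}"
    have "ideal_of S ?Q"
      unfolding ideal_of_def
    proof (intro conjI ballI)
      show "?Q \<subseteq> S" "0 \<in> ?Q" using PD(2) S.zero_in JSD(2) by auto
    next
      fix x y assume "x \<in> ?Q" "y \<in> ?Q"
      then obtain e f where *: "x \<in> S" "y \<in> S" "e \<in> P" "f \<in> P" "x * (1 - e) \<in> J" "y * (1 - f) \<in> J"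
        by blast
      have ef: "e \<in> S" "f \<in> S" using *(3,4) PD(1) RS by auto
      have "1 - e \<in> S" "1 - f \<in> S" using ef S.ring_in by auto
      \<comment> \<open>The product \<open>(1 - e) * (1 - f)\<close> kills \<open>x\<close> and
        \<open>y\<close> modulo \<open>J\<close>, and it equals
        \<open>1 - (e + f - e * f)\<close>.\<close>
      then have "(1 - f) * (x * (1 - e)) + (1 - e) * (y * (1 - f)) \<in> J"
        using * JSD(3,4) by blast
      then have "(x + y) * (1 - (e + f - e * f)) \<in> J" by (simp add: algebra_simps)
      moreover have "e + f - e * f \<in> P"
        using *(3,4) PD(1,3,4) R.ideal_of_diff[OF prime_ofD(1)[OF P]] by blast
      ultimately show "x + y \<in> ?Q" using * S.add_in by blast
    next
      fix a x assume a: "a \<in> S" and "x \<in> ?Q"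
      then obtain e where "x \<in> S" "e \<in> P" "x * (1 - e) \<in> J" by blast
      then show "a * x \<in> ?Q" using a JSD(4) S.mult_in by (auto simp: mult.assoc)
    qed
    moreover have "1 \<notin> ?Q"
    proof
      assume "1 \<in> ?Q"
      then obtain e where "e \<in> P" "1 - e \<in> P" using True by auto
      then have "e + (1 - e) \<in> P" by (rule PD(3))
      then show False using prime_ofD(2)[OF P] by simp
    qed
    moreover have "a \<in> ?Q \<or> b \<in> ?Q" if ab: "a \<in> S" "b \<in> S" "a * b \<in> ?Q" for a b
    proof -
      obtain e where e: "e \<in> P" "(a * b) * (1 - e) \<in> J" using ab by blast
      obtain d d' where d: "d \<in> S" "a - a\<^sup>2 * d \<in> J" "a * d \<in> R" "d' \<in> S" "b - b\<^sup>2 * d' \<in> J" "b * d' \<in> R"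
        using reg[OF ab(1)] reg[OF ab(2)] by blast
      \<comment> \<open>Multiplying by \<open>d * d'\<close> replaces \<open>a\<close> and
        \<open>b\<close> by the idempotents \<open>a * d\<close> and \<open>b * d'\<close>, which
        lie in \<open>R\<close>, where primality of \<open>P\<close> applies. The one found in
        \<open>P\<close> is the witness \<open>e\<close> for \<open>a\<close> or
        \<open>b\<close>.\<close>
      have "(d * d') * ((a * b) * (1 - e)) \<in> P" using e d JSD(4) S.mult_in True by blast
      then have "((a * d) * (b * d')) * (1 - e) \<in> P" by (simp add: algebra_simps)
      moreover have "1 - e \<notin> P"
      proof
        assume "1 - e \<in> P"
        then have "(1 - e) + e \<in> P" using e PD(3) by blast
        then show False using prime_ofD(2)[OF P] by simp
      qed
      moreover have "1 - e \<in> R" using PD(1)[OF e(1)] by (simp add: R.ring_in)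
      ultimately have "a * d \<in> P \<or> b * d' \<in> P"
        using prime_ofD(3)[OF P] d R.mult_in by blast
      moreover have "a * (1 - a * d) \<in> J" "b * (1 - b * d') \<in> J"
        using d by (simp_all add: power2_eq_square algebra_simps)
      ultimately show ?thesis using ab by blast
    qed
    ultimately have "prime_of S ?Q" unfolding prime_of_def by blast
    moreover have "P = ?Q \<inter> R"
    proof (intro equalityI subsetI)
      fix x assume x: "x \<in> P"
      obtain d where d: "d \<in> S" "x - x\<^sup>2 * d \<in> J" "x \<in> R \<longrightarrow> d \<in> R" using reg x PD(1) RS by blast
      have "x * d \<in> P" using d x PD(1,5) by blast
      moreover have "x * (1 - x * d) \<in> J" using d by (simp add: power2_eq_square algebra_simps)
      ultimately show "x \<in> ?Q \<inter> R" using x PD(1) RS by blast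
    next
      fix x assume "x \<in> ?Q \<inter> R"
      then obtain e where e: "x \<in> R" "e \<in> P" "x * (1 - e) \<in> P" using True by blast
      then have "x * (1 - e) + x * e \<in> P" using PD(3,4) by blast
      then show "x \<in> P" by (simp add: algebra_simps)
    qed
    ultimately show ?thesis by blast
  qed
qed

section \<open>Pruefer domains and their localizations\<close>

lemma domain_set_if_pruefer: "pruefer_domain A \<Longrightarrow> domain_set A"
  by (simp add: pruefer_domain_def domain_set_iff)

text \<open>Only two-generated ideals are used: for \<open>y = a / b\<close>, invertibility of the
  ideal of \<open>a\<close> and \<open>b\<close> yields \<open>1 = c * a + d * b\<close> with
  \<open>c\<close> and \<open>d\<close> in its inverse.\<close>

lemma pruefer_domainD:
  assumes A: "pruefer_domain A" and y: "y \<in> fraction_field A" "y \<noteq> 0"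
  shows "\<exists>u\<in>A. u / y \<in> A \<and> (1 - u) * y \<in> A"
proof -
  interpret domain_set A by (rule domain_set_if_pruefer[OF A])
  obtain a b where ab: "y = a / b" "a \<in> A" "b \<in> A" "b \<noteq> 0"
    using y unfolding fraction_field_def by blast
  let ?I = "genideal (ring_on A) {a, b}"
  have ab_I: "a \<in> ?I" "b \<in> ?I" using genideal_least(2)[of "{a, b}"] ab by auto
  then have "?I \<noteq> {0}" using ab by auto
  then have "invertible_ideal A ?I" using A ab unfolding pruefer_domain_def by auto
  then have "1 \<in> ?I \<cdot>\<^bsub>ring_of_type_algebra\<^esub> ideal_inverse A ?I"
    using one_in by (simp add: invertible_ideal_def)
  moreover have "?I \<subseteq> {p + b * q |q p. q \<in> A \<and> p \<in> {x * a |x. x \<in> A}}"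
  proof (rule genideal_least(3))
    have "ideal_of A {x * a |x. x \<in> A}"
      using cring.cgenideal_ideal[OF cring_ring_on, of a] ab by (simp add: ideal_iff cgenideal_eq)
    then show "ideal_of A {p + b * q |q p. q \<in> A \<and> p \<in> {x * a |x. x \<in> A}}"
      using ab(3) by (rule ideal_of_adjoin)
    have "a = 1 * a + b * 0" "b = 0 * a + b * 1" by simp_all
    then show "{a, b} \<subseteq> {p + b * q |q p. q \<in> A \<and> p \<in> {x * a |x. x \<in> A}}"
      using zero_in one_in by blast
  qed
  \<comment> \<open>The induction shows the form \<open>c * a + d * b\<close> for every element of
    the product; it rests on the inverse being closed under sums and under multiplication by
    \<open>A\<close>.\<close>
  ultimately have "\<exists>c\<in>ideal_inverse A ?I. \<exists>d\<in>ideal_inverse A ?I. 1 = c * a + d * b"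
  proof (induction rule: ideal_prod.induct)
    case (prod i j)
    then obtain x z where xz: "i = x * a + b * z" "x \<in> A" "z \<in> A" by blast
    have "x' * j \<in> ideal_inverse A ?I" if x': "x' \<in> A" for x'
    proof -
      have "j \<in> fraction_field A" and jI: "\<And>i. i \<in> ?I \<Longrightarrow> j * i \<in> A"
        using prod(2) by (auto simp: ideal_inverse_def)
      then obtain p q where "j = p / q" "p \<in> A" "q \<in> A" "q \<noteq> 0" unfolding fraction_field_def by blast
      then have "x' * j = (x' * p) / q" "x' * p \<in> A" using x' mult_in by auto
      then have "x' * j \<in> fraction_field A" using \<open>q \<in> A\<close> \<open>q \<noteq> 0\<close> unfolding fraction_field_def by blast
      then show ?thesis using jI x' mult_in by (auto simp: ideal_inverse_def mult.assoc)
    qed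
    then have "x * j \<in> ideal_inverse A ?I" "z * j \<in> ideal_inverse A ?I" using xz by auto
    moreover have "i * j = (x * j) * a + (z * j) * b" using xz by (simp add: algebra_simps)
    ultimately show ?case by (auto simp del: mult.assoc)
  next
    case (sum s1 s2)
    then obtain c d c' d' where *: "c \<in> ideal_inverse A ?I" "d \<in> ideal_inverse A ?I"
      "s1 = c * a + d * b" "c' \<in> ideal_inverse A ?I" "d' \<in> ideal_inverse A ?I" "s2 = c' * a + d' * b"
      by blast
    have add: "x + z \<in> ideal_inverse A ?I" if xz: "x \<in> ideal_inverse A ?I" "z \<in> ideal_inverse A ?I" for x z
    proof -
      obtain p q r s where "x = p / q" "z = r / s" "p \<in> A" "q \<in> A" "q \<noteq> 0" "r \<in> A" "s \<in> A" "s \<noteq> 0"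
        using xz unfolding ideal_inverse_def fraction_field_def by blast
      then have "x + z = (p * s + r * q) / (q * s)" "p * s + r * q \<in> A" "q * s \<in> A" "q * s \<noteq> 0"
        using add_in mult_in by (auto simp: field_simps)
      then have "x + z \<in> fraction_field A" unfolding fraction_field_def by blast
      then show ?thesis using xz add_in by (auto simp: ideal_inverse_def distrib_right)
    qed
    have "s1 + s2 = (c + c') * a + (d + d') * b" unfolding *(3,6) by (simp add: algebra_simps)
    then show ?case using add[OF *(1,4)] add[OF *(2,5)] by auto
  qed
  then obtain c d where cd: "c \<in> ideal_inverse A ?I" "d \<in> ideal_inverse A ?I" "1 = c * a + d * b"
    by blast
  \<comment> \<open>The witness is \<open>u = c * a\<close>: then \<open>u / y = c * b\<close> and
    \<open>(1 - u) * y = d * a\<close>.\<close>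
  have I: "c * a \<in> A" "c * b \<in> A" "d * a \<in> A" using cd(1,2) ab_I by (auto simp: ideal_inverse_def)
  have "a \<noteq> 0" using ab y by auto
  then have "c * a / y = c * b" using ab by simp
  moreover have "1 - c * a = d * b" using cd(3) by (metis add_diff_cancel_left')
  then have "(1 - c * a) * y = d * a" using ab by simp
  ultimately show ?thesis using I by (intro bexI[of _ "c * a"]) simp_all
qed

text \<open>
  A family \<open>e\<close> with \<open>\<Sum> e\<^sub>s = 1\<close> and \<open>e\<^sub>s s' / s \<in> A\<close> exhibits the inverse of the ideal generated by \<open>F\<close>.
\<close>

lemma (in domain_set) exists_partition:
  assumes split: "\<And>y. y \<noteq> 0 \<Longrightarrow> \<exists>u\<in>A. u / y \<in> A \<and> (1 - u) * y \<in> A"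
    and "finite F" "F \<noteq> {}" "F \<subseteq> A - {0}"
  shows "\<exists>e. (\<forall>s\<in>F. \<forall>s'\<in>F. e s * s' / s \<in> A) \<and> sum e F = 1"
  using assms(2-4)
proof (induction rule: finite_ne_induct)
  case (singleton x)
  then show ?case using one_in by (intro exI[of _ "\<lambda>_. 1"]) auto
next
  case (insert r F)
  then obtain e where e: "\<And>s s'. s \<in> F \<Longrightarrow> s' \<in> F \<Longrightarrow> e s * s' / s \<in> A" "sum e F = 1" by auto
  have nz: "r \<noteq> 0" "\<And>s. s \<in> F \<Longrightarrow> s \<noteq> 0" using insert by auto
  have "\<exists>u\<in>A. u / (s / r) \<in> A \<and> (1 - u) * (s / r) \<in> A" if "s \<in> F" for s
    using split[of "s / r"] nz(1) nz(2)[OF that] by simp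
  then obtain u where u: "\<And>s. s \<in> F \<Longrightarrow> u s \<in> A \<and> u s / (s / r) \<in> A \<and> (1 - u s) * (s / r) \<in> A"
    by metis
  \<comment> \<open>For each old \<open>s\<close>, \<open>u s\<close> splits the pair
    \<open>s\<close>, \<open>r\<close>: the share \<open>u s\<close> of \<open>e s\<close> stays
    with \<open>s\<close>, and the rest goes to the new element \<open>r\<close>.\<close>
  define e' where "e' s = (if s = r then \<Sum>s\<in>F. e s * (1 - u s) else e s * u s)" for s
  have eA: "e s \<in> A" if "s \<in> F" for s using e(1)[OF that that] nz(2)[OF that] by simp
  have r: "s \<noteq> r" if "s \<in> F" for s using that insert by auto
  have "sum e' (insert r F) = (\<Sum>s\<in>F. e s * (1 - u s)) + (\<Sum>s\<in>F. e s * u s)"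
    using insert r by (simp add: e'_def cong: sum.cong)
  also have "\<dots> = sum e F" by (simp add: sum.distrib[symmetric] algebra_simps)
  finally have "sum e' (insert r F) = 1" using e by simp
  moreover have "e' s * s' / s \<in> A" if s: "s \<in> insert r F" "s' \<in> insert r F" for s s'
  proof (cases "s = r")
    case True
    have "e' s * s' / s = (\<Sum>s\<in>F. e s * (1 - u s) * s' / r)"
      by (simp add: e'_def True sum_distrib_right sum_divide_distrib)
    also have "\<dots> \<in> A"
    proof (rule sum_in)
      fix w assume w: "w \<in> F"
      show "e w * (1 - u w) * s' / r \<in> A"
      proof (cases "s' = r")
        case True
        then show ?thesis using nz eA[OF w] u[OF w] by (simp add: ring_in)
      next
        case False
        then have "s' \<in> F" using s by simp
        have "(e w * s' / w) * ((1 - u w) * (w / r)) \<in> A"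
          using u[OF w] by (intro mult_in[OF e(1)[OF w \<open>s' \<in> F\<close>]]) blast
        moreover have "(e w * s' / w) * ((1 - u w) * (w / r)) = e w * (1 - u w) * s' / r"
          using nz(1) nz(2)[OF w] by (simp add: field_simps)
        ultimately show ?thesis by metis
      qed
    qed
    finally show ?thesis .
  next
    case False
    then have sF: "s \<in> F" using s by auto
    show ?thesis
    proof (cases "s' = r")
      case True
      have "e s * (u s / (s / r)) \<in> A" by (rule mult_in) (use u[OF sF] eA[OF sF] in auto)
      then show ?thesis using True False by (simp add: e'_def mult.assoc)
    next
      case False
      then have "s' \<in> F" using s by simp
      have "(e s * s' / s) * u s \<in> A"
        using u[OF sF] by (intro mult_in[OF e(1)[OF sF \<open>s' \<in> F\<close>]]) blast
      then show ?thesis using \<open>s \<noteq> r\<close> by (simp add: e'_def mult_ac)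
    qed
  qed
  ultimately show ?case by blast
qed

text \<open>A splitting of every nonzero \<open>y\<close> also forces the ambient field to be the
  field of fractions: either \<open>u = 0\<close> and \<open>y\<close> is in \<open>A\<close>, or
  \<open>y\<close> is the quotient of \<open>u\<close> by \<open>u / y\<close>.\<close>

lemma pruefer_domainI:
  assumes A: "domain_set A"
    and split: "\<And>y. y \<noteq> 0 \<Longrightarrow> \<exists>u\<in>A. u / y \<in> A \<and> (1 - u) * y \<in> A"
  shows "pruefer_domain A"
  unfolding pruefer_domain_def
proof (intro conjI allI impI)
  interpret domain_set A by fact
  show "is_domain A" using A by (simp add: domain_set_iff)
  fix F assume F: "finite F" "F \<subseteq> A" "genideal (ring_on A) F \<noteq> {0}"
  let ?I = "genideal (ring_on A) F"
  note II = ideal_ofD[OF genideal_least(1)[OF F(2)]]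
  let ?F = "F - {0}"
  have "ideal_of A {0}" using zero_in by (simp add: ideal_of_def)
  then have "?F \<noteq> {}" using genideal_least(3)[of "{0}" F] II(2) F(3) by blast
  moreover have "finite ?F" "?F \<subseteq> A - {0}" using F by auto
  ultimately obtain e where e: "\<And>s s'. s \<in> ?F \<Longrightarrow> s' \<in> ?F \<Longrightarrow> e s * s' / s \<in> A" "sum e ?F = 1"
    using exists_partition[OF split, of ?F] by blast
  have eA: "e s \<in> A" if "s \<in> ?F" for s using e(1)[OF that that] that by simp
  have inv: "e s / s \<in> ideal_inverse A ?I" if s: "s \<in> ?F" for s
  proof -
    have "ideal_of A {a \<in> A. (e s / s) * a \<in> A}"
      unfolding ideal_of_def using zero_in add_in mult_in
      by (auto simp: distrib_left add_divide_distrib) (metis mult.assoc mult.commute times_divide_eq_left)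
    moreover have "F \<subseteq> {a \<in> A. (e s / s) * a \<in> A}"
      using F(2) e(1)[OF s] zero_in by force
    ultimately have "?I \<subseteq> {a \<in> A. (e s / s) * a \<in> A}" by (rule genideal_least(3))
    moreover have "e s / s \<in> fraction_field A"
      using s eA[OF s] F(2) unfolding fraction_field_def by blast
    ultimately show ?thesis unfolding ideal_inverse_def by blast
  qed
  show "invertible_ideal A ?I"
    unfolding invertible_ideal_def
  proof (intro equalityI subsetI)
    fix z assume "z \<in> ?I \<cdot>\<^bsub>ring_of_type_algebra\<^esub> ideal_inverse A ?I"
    then show "z \<in> A"
      by induction (auto simp: ideal_inverse_def mult.commute intro: add_in)
  next
    fix z assume z: "z \<in> A"
    let ?P = "?I \<cdot>\<^bsub>ring_of_type_algebra\<^esub> ideal_inverse A ?I"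
    \<comment> \<open>Factor as \<open>(z * s) * (e s / s)\<close>; summation over \<open>s\<close>
      then gives \<open>z\<close>.\<close>
    have mem: "z * e s \<in> ?P" if s: "s \<in> ?F" for s
    proof -
      have "z * s \<in> ?I" using s z II(4) genideal_least(2)[OF F(2)] by blast
      from ideal_prod.prod[OF this inv[OF s], of ring_of_type_algebra] show ?thesis using s by simp
    qed
    \<comment> \<open>\<open>ideal_prod\<close> is generated by products and binary sums, so the
      empty sum must itself be written as a product.\<close>
    obtain s where "s \<in> ?F" using \<open>?F \<noteq> {}\<close> by blast
    from ideal_prod.prod[OF II(2) inv[OF this], of ring_of_type_algebra] have "0 \<in> ?P" by simp
    moreover have "finite G \<Longrightarrow> G \<subseteq> ?F \<Longrightarrow> 0 \<in> ?P \<Longrightarrow> (\<Sum>s\<in>G. z * e s) \<in> ?P" for G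
    proof (induction rule: finite_induct)
      case (insert s G)
      then have "z * e s \<in> ?P" "(\<Sum>s\<in>G. z * e s) \<in> ?P" using mem[of s] by auto
      from ideal_prod.sum[OF this] show ?case using insert by simp
    qed simp
    ultimately have "(\<Sum>s\<in>?F. z * e s) \<in> ?P" using \<open>finite ?F\<close> by blast
    then show "z \<in> ?P" using e(2) by (simp add: sum_distrib_left[symmetric])
  qed
qed

context domain_set
begin

lemma domain_set_localization:
  assumes P: "prime_of A P"
  shows "domain_set (localization_at A P)"
proof
  have one: "1 \<notin> P" using prime_ofD(2)[OF P] .
  have "0 = 0 / (1::'a)" "1 = 1 / (1::'a)" by simp_all
  then show "0 \<in> localization_at A P" "1 \<in> localization_at A P"
    unfolding localization_at_def using zero_in one_in one by blast+
  fix x assume "x \<in> localization_at A P"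
  then obtain a s where x: "x = a / s" "a \<in> A" "s \<in> A" "s \<notin> P"
    unfolding localization_at_def by blast
  have "- x = (- a) / s" using x by simp
  then show "- x \<in> localization_at A P"
    unfolding localization_at_def using x uminus_in[OF x(2)] by blast
  fix y assume "y \<in> localization_at A P"
  then obtain b r where y: "y = b / r" "b \<in> A" "r \<in> A" "r \<notin> P"
    unfolding localization_at_def by blast
  have "s \<noteq> 0" "r \<noteq> 0" using x y ideal_ofD(2)[OF prime_ofD(1)[OF P]] by auto
  then have "x + y = (a * r + b * s) / (s * r)" "x * y = (a * b) / (s * r)"
    using x y by (auto simp: field_simps)
  moreover have "s * r \<in> A" "s * r \<notin> P" "a * r + b * s \<in> A" "a * b \<in> A"
    using x y prime_ofD(3)[OF P] by (auto simp: ring_in)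
  ultimately show "x + y \<in> localization_at A P" "x * y \<in> localization_at A P"
    unfolding localization_at_def by blast+
qed

text \<open>Not both \<open>u\<close> and \<open>1 - u\<close> lie in \<open>P\<close>; the one
  outside is a denominator for \<open>inverse y\<close> or for \<open>y\<close>,
  respectively.\<close>

lemma localization_valuation:
  assumes split: "\<And>y. y \<noteq> 0 \<Longrightarrow> \<exists>u\<in>A. u / y \<in> A \<and> (1 - u) * y \<in> A"
    and P: "prime_of A P" and y: "y \<noteq> 0"
  shows "y \<in> localization_at A P \<or> inverse y \<in> localization_at A P"
proof -
  obtain u where u: "u \<in> A" "u / y \<in> A" "(1 - u) * y \<in> A" using split[OF y] by blast
  show ?thesis
  proof (cases "u \<in> P")
    case True
    have "1 - u \<notin> P"
    proof
      assume "1 - u \<in> P"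
      then have "(1 - u) + u \<in> P" using True ideal_ofD(3)[OF prime_ofD(1)[OF P]] by blast
      then show False using prime_ofD(2)[OF P] by simp
    qed
    moreover from this have "y = ((1 - u) * y) / (1 - u)"
      using ideal_ofD(2)[OF prime_ofD(1)[OF P]] by auto
    ultimately show ?thesis
      using u diff_in[OF one_in u(1)] unfolding localization_at_def by blast
  next
    case False
    moreover from this have "inverse y = (u / y) / u"
      using y ideal_ofD(2)[OF prime_ofD(1)[OF P]] by (auto simp: field_simps)
    ultimately show ?thesis using u unfolding localization_at_def by blast
  qed
qed

end

section \<open>Valuation rings with an element of bounded small value\<close>

text \<open>
  The last assumption says \<open>0 < v(c) \<Longrightarrow> v(t) < n v(c)\<close>; together with \<open>v(t) > 0\<close> it forces \<open>n > 0\<close>.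
\<close>

locale pointed_valuation = domain_set V for V :: "'a::field set" +
  fixes t :: 'a and n :: nat
  assumes valuation_ring: "y \<noteq> 0 \<Longrightarrow> y \<in> V \<or> inverse y \<in> V"
    and t_in: "t \<in> V" and t_nonzero: "t \<noteq> 0" and t_nonunit: "inverse t \<notin> V"
    and small: "c \<in> V \<Longrightarrow> c \<noteq> 0 \<Longrightarrow> inverse c \<notin> V \<Longrightarrow> t / c ^ n \<notin> V"
begin

text \<open>The maximal ideal of the valuation ring, as its set of nonunits. Zero is listed
  separately because \<open>inverse 0 = 0\<close> lies in \<open>V\<close>.\<close>

definition M :: "'a set"
  where "M = {x \<in> V. x = 0 \<or> inverse x \<notin> V}"

lemma M_subset: "x \<in> M \<Longrightarrow> x \<in> V"
  by (simp add: M_def)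

lemma M_mult: "a \<in> V \<Longrightarrow> x \<in> M \<Longrightarrow> a * x \<in> M"
proof -
  assume a: "a \<in> V" and x: "x \<in> M"
  have "inverse (a * x) \<notin> V" if nz: "a * x \<noteq> 0"
  proof
    assume "inverse (a * x) \<in> V"
    then have "a * inverse (a * x) \<in> V" using a by (rule mult_in[rotated])
    moreover have "a * inverse (a * x) = inverse x" using nz by (simp add: field_simps)
    ultimately have "inverse x \<in> V" by metis
    then show False using nz x by (simp add: M_def)
  qed
  then show ?thesis using a x by (auto simp: M_def mult_in)
qed

text \<open>Of two nonzero elements one divides the other, so the sum is a multiple of one of
  them.\<close>

lemma M_add: "x \<in> M \<Longrightarrow> y \<in> M \<Longrightarrow> x + y \<in> M"
proof -
  have *: "x + y \<in> M" if "x \<in> M" "y \<in> M" "y \<noteq> 0" "x / y \<in> V" for x y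
  proof -
    have "x + y = (x / y + 1) * y" using that by (simp add: field_simps)
    then show ?thesis using M_mult[OF add_in[OF that(4) one_in] that(2)] by simp
  qed
  assume "x \<in> M" "y \<in> M"
  then show ?thesis
    using *[of x y] *[of y x] valuation_ring[of "x / y"]
    by (cases "x = 0 \<or> y = 0") (auto simp: add.commute)
qed

lemma ideal_of_M: "ideal_of V M"
  using M_subset M_mult M_add zero_in unfolding ideal_of_def by (auto simp: M_def)

lemma unit_add_M:
  assumes "u \<in> V" "u \<noteq> 0" "inverse u \<in> V" "x \<in> M"
  shows "u + x \<noteq> 0" "inverse (u + x) \<in> V"
proof -
  have "u + x \<notin> M"
  proof
    assume "u + x \<in> M"
    from ideal_of_diff[OF ideal_of_M this assms(4)] have "u \<in> M" by simp
    then show False using assms by (simp add: M_def)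
  qed
  then show "u + x \<noteq> 0" "inverse (u + x) \<in> V"
    using add_in[OF assms(1) M_subset[OF assms(4)]] by (auto simp: M_def)
qed

lemma t_in_M: "t \<in> M"
  using t_in t_nonunit by (simp add: M_def)

lemma n_pos: "n > 0"
  using small[OF t_in t_nonzero t_nonunit] t_in by (cases n) auto

lemma power_over_t:
  assumes "c \<in> M" "c \<noteq> 0"
  shows "c ^ n / t \<in> M"
proof -
  have "t / c ^ n \<notin> V" using small assms by (auto simp: M_def)
  moreover have "inverse (c ^ n / t) = t / c ^ n" by simp
  ultimately show ?thesis
    using valuation_ring[of "c ^ n / t"] assms t_nonzero by (auto simp: M_def)
qed

text \<open>The exponent \<open>Suc n\<close> leaves room for dividing by \<open>y\<close>: if v(y)
  > 0, even \<open>y ^ n\<close> has value above v(t). The two memberships in \<open>M\<close> are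
  the defects of \<open>y ^ n / h\<close> as a quasi-inverse of \<open>y\<close>.\<close>

lemma denominator_values:
  fixes y
  defines "h \<equiv> t + y ^ Suc n"
  shows "h \<noteq> 0" "y ^ Suc n / h \<in> V" "y ^ n / h \<in> V" "t * y / h \<in> V"
    and "y \<in> V \<Longrightarrow> t * y / h \<in> M" "y \<in> V \<Longrightarrow> y ^ n / h * t / h \<in> M"
proof -
  have "h \<noteq> 0 \<and> y ^ Suc n / h \<in> V \<and> y ^ n / h \<in> V \<and> t * y / h \<in> V \<and>
    (y \<in> V \<longrightarrow> t * y / h \<in> M \<and> y ^ n / h * t / h \<in> M)"
  proof -
    \<comment> \<open>In the order zero, v(y) = 0, v(y) > 0, v(y) < 0, the element \<open>h\<close>
      is \<open>t\<close>, a unit, \<open>t\<close> times a unit, and \<open>y ^ Suc n\<close> times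
      a unit.\<close>
    consider "y = 0" | "y \<noteq> 0" "y \<in> V" "inverse y \<in> V" | "y \<in> M" "y \<noteq> 0" | "y \<noteq> 0" "y \<notin> V"
      by (auto simp: M_def)
    then show ?thesis
    proof cases
      case 1
      then show ?thesis using t_nonzero n_pos zero_in by (simp add: h_def M_def zero_power)
    next
      case 2
      have "inverse (y ^ Suc n) \<in> V" using power_in[OF 2(3), of "Suc n"] by (simp only: power_inverse)
      then have h: "h \<noteq> 0" "inverse h \<in> V"
        using unit_add_M[OF power_in[OF 2(2)] _ _ t_in_M, of "Suc n"] 2(1)
        by (simp_all add: h_def add.commute)
      have "(y * inverse h) * t \<in> M" "(y ^ n * inverse h * inverse h) * t \<in> M"
        using 2 h by (auto intro!: M_mult[OF _ t_in_M] mult_in power_in)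
      then have "t * y / h \<in> M" "y ^ n / h * t / h \<in> M"
        by (simp_all add: divide_inverse mult_ac)
      moreover have "y ^ Suc n / h \<in> V" "y ^ n / h \<in> V"
        using mult_in[OF power_in[OF 2(2)] h(2)] by (simp_all only: divide_inverse)
      ultimately show ?thesis using h M_subset by blast
    next
      case 3
      define z where "z = y ^ n / t"
      define w where "w = 1 + y * z"
      have z: "z \<in> M" unfolding z_def by (rule power_over_t[OF 3])
      then have w: "w \<noteq> 0" "inverse w \<in> V"
        using unit_add_M[OF one_in, of "y * z"] one_in M_mult[OF M_subset[OF 3(1)]]
        by (simp_all add: w_def)
      have h: "h = t * w" using t_nonzero by (simp add: h_def w_def z_def distrib_left)
      have yn: "y ^ n / h = inverse w * z" using h w t_nonzero by (simp add: z_def field_simps)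
      then have 1: "y ^ n / h \<in> M" using M_mult[OF w(2) z] by simp
      have "y ^ Suc n / h = y * (y ^ n / h)" by simp
      then have 2: "y ^ Suc n / h \<in> V" using mult_in[OF M_subset[OF 3(1)] M_subset[OF 1]] by simp
      have ty: "t * y / h = inverse w * y" using h w t_nonzero by (simp add: field_simps)
      have "t / h = inverse w" using h w t_nonzero by (simp add: field_simps)
      then have "y ^ n / h * t / h = inverse w * (y ^ n / h)"
        by (metis mult.commute times_divide_eq_right)
      then have "y ^ n / h * t / h \<in> M" using M_mult[OF w(2) 1] by simp
      moreover have "h \<noteq> 0" using h w t_nonzero by simp
      ultimately show ?thesis using 1 2 ty M_mult[OF w(2) 3(1)] M_subset by auto
    next
      case 4
      define x where "x = inverse y"
      define w where "w = 1 + x ^ Suc n * t"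
      have x: "x \<in> V" "x \<noteq> 0" using valuation_ring[OF 4(1)] 4 by (auto simp: x_def)
      have w: "w \<noteq> 0" "inverse w \<in> V"
        using unit_add_M[OF one_in _ _ M_mult[OF power_in[OF x(1)] t_in_M], of "Suc n"] one_in
        by (simp_all add: w_def)
      have y: "y = inverse x" by (simp add: x_def)
      have h: "h = inverse x ^ Suc n * w"
        using x by (simp add: h_def w_def y field_simps)
      have "y ^ Suc n / h = inverse w" "y ^ n / h = x * inverse w" "t * y / h = t * x ^ n * inverse w"
        using x w by (simp_all add: h y field_simps)
      moreover have "h \<noteq> 0" using h w x by simp
      ultimately show ?thesis using 4 w x t_in by (simp add: ring_in)
    qed
  qed
  then show "h \<noteq> 0" "y ^ Suc n / h \<in> V" "y ^ n / h \<in> V" "t * y / h \<in> V"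
    and "y \<in> V \<Longrightarrow> t * y / h \<in> M" "y \<in> V \<Longrightarrow> y ^ n / h * t / h \<in> M"
    by auto
qed

text \<open>Clearing the denominator of \<open>y = f / g\<close> lets the estimates cover
  \<open>g = 0\<close> too, that is, the poles of a rational function.\<close>

lemma homogeneous_denominator_values:
  assumes "f \<noteq> 0 \<or> g \<noteq> 0"
  defines "h \<equiv> t * g ^ Suc n + f ^ Suc n"
  shows "h \<noteq> 0" "f ^ Suc n / h \<in> V" "f ^ n * g / h \<in> V" "t * g ^ n * f / h \<in> V"
proof -
  have "h \<noteq> 0 \<and> f ^ Suc n / h \<in> V \<and> f ^ n * g / h \<in> V \<and> t * g ^ n * f / h \<in> V"
  proof (cases "g = 0")
    case True
    \<comment> \<open>Here \<open>h = f ^ Suc n\<close>, and \<open>n > 0\<close> makes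
      \<open>g ^ n\<close> vanish.\<close>
    then show ?thesis using assms(1) n_pos zero_in one_in by (simp add: h_def zero_power)
  next
    case False
    have h: "h = g ^ Suc n * (t + (f / g) ^ Suc n)"
      using False by (simp add: h_def power_divide field_simps)
    note * = denominator_values[of "f / g"]
    have "f ^ Suc n / h = (f / g) ^ Suc n / (t + (f / g) ^ Suc n)"
      "f ^ n * g / h = (f / g) ^ n / (t + (f / g) ^ Suc n)"
      "t * g ^ n * f / h = t * (f / g) / (t + (f / g) ^ Suc n)"
      unfolding h using False *(1) by (simp_all add: power_divide divide_simps)
    then show ?thesis using * False h by simp
  qed
  then show "h \<noteq> 0" "f ^ Suc n / h \<in> V" "f ^ n * g / h \<in> V" "t * g ^ n * f / h \<in> V" by auto
qed

end

text \<open>A nonunit \<open>c\<close> is a multiple of the generator \<open>\<tau>\<close> of the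
  maximal ideal, so v(t) < n v(\<tau>) \<le> n v(c).\<close>

lemma pointed_valuation_localization:
  assumes T: "pruefer_domain T" "fraction_field T = UNIV" and m: "maximalideal m (ring_on T)"
    and \<tau>: "\<tau> \<in> localization_at T m"
      "maximalideal (cgenideal (ring_on (localization_at T m)) \<tau>) (ring_on (localization_at T m))"
    and pos: "value_less (localization_at T m) (value_zero (localization_at T m))
        (valuation (localization_at T m) t)"
    and less: "value_less (localization_at T m) (valuation (localization_at T m) t)
        (value_times (localization_at T m) n (valuation (localization_at T m) \<tau>))"
  shows "pointed_valuation (localization_at T m) t n"
proof -
  interpret T: domain_set T by (rule domain_set_if_pruefer[OF T(1)])
  have m: "prime_of T m" using m T.maximalideal_iff T.maximal_of_prime by blast
  define V where "V = localization_at T m"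
  interpret V: domain_set V unfolding V_def by (rule T.domain_set_localization[OF m])
  have V: "is_domain V" using V.domain_set_axioms by (simp add: domain_set_iff)
  have val: "y \<in> V \<or> inverse y \<in> V" if "y \<noteq> 0" for y
    unfolding V_def using pruefer_domainD[OF T(1)] T(2) that by (intro T.localization_valuation[OF _ m]) auto
  \<comment> \<open>The value of 0 is infinite and never the smaller one.\<close>
  have "t \<noteq> 0" using less by (auto simp: value_less_def valuation_def)
  then have t: "t \<in> V" "inverse t \<notin> V"
    using pos value_less_iff[OF V, of 1 t] value_zero_eq[OF V]
    by (simp_all flip: V_def add: inverse_eq_divide)
  have max: "maximal_of V {x * \<tau> |x. x \<in> V}"
    using \<tau>(2) V.maximalideal_iff V.cgenideal_eq by (simp flip: V_def)
  \<comment> \<open>Otherwise 0 would be the maximal ideal and the nonzero nonunit \<open>t\<close>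
    would be invertible.\<close>
  have "\<tau> \<noteq> 0"
  proof
    assume "\<tau> = 0"
    then have "t \<notin> {x * \<tau> |x. x \<in> V}" using \<open>t \<noteq> 0\<close> by auto
    then obtain x where "x \<in> V" "1 - t * x \<in> {x * \<tau> |x. x \<in> V}"
      using max t(1) unfolding maximal_of_def by blast
    then have "t * x = 1" using \<open>\<tau> = 0\<close> by auto
    then show False using \<open>x \<in> V\<close> t(2) by (metis inverse_unique)
  qed
  then have \<tau>n: "t / \<tau> ^ n \<notin> V"
    using less value_less_iff[OF V \<open>t \<noteq> 0\<close>, of "\<tau> ^ n"] value_times_eq[OF V, of \<tau> n]
    by (simp flip: V_def)
  have "t / c ^ n \<notin> V" if c: "c \<in> V" "c \<noteq> 0" "inverse c \<notin> V" for c
  proof -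
    \<comment> \<open>Otherwise \<open>\<tau> / c\<close> lies in \<open>V\<close> and
      \<open>c\<close> is invertible modulo \<open>\<tau>\<close>; dividing
      \<open>1 = c x + y \<tau>\<close> by \<open>c\<close> puts \<open>inverse c\<close> into
      \<open>V\<close>.\<close>
    have "c / \<tau> \<in> V"
    proof (rule ccontr)
      assume n: "c / \<tau> \<notin> V"
      then have "\<tau> / c \<in> V" using val[of "c / \<tau>"] c \<open>\<tau> \<noteq> 0\<close> by simp
      have "c \<notin> {x * \<tau> |x. x \<in> V}" using n \<open>\<tau> \<noteq> 0\<close> by auto
      then obtain x y where xy: "x \<in> V" "y \<in> V" "1 - c * x = y * \<tau>"
        using max c(1) unfolding maximal_of_def by blast
      then have "1 = c * x + y * \<tau>" by (metis diff_eq_eq add.commute)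
      then have "inverse c = x + y * (\<tau> / c)" using c(2) by (simp add: field_simps)
      also have "\<dots> \<in> V" using xy \<open>\<tau> / c \<in> V\<close> by (simp add: V.add_in V.mult_in del: times_divide_eq_right)
      finally show False using c(3) by blast
    qed
    moreover have "t / \<tau> ^ n = (t / c ^ n) * (c / \<tau>) ^ n" using c(2) by (simp add: power_divide)
    ultimately show ?thesis using \<tau>n V.mult_in[OF _ V.power_in] by metis
  qed
  then have "pointed_valuation V t n"
    using val t \<open>t \<noteq> 0\<close> by unfold_locales auto
  then show ?thesis by (simp add: V_def)
qed

section \<open>Values of rational functions\<close>

definition const_fun :: "'k::field \<Rightarrow> 'k poly fract"
  where "const_fun c = Fract [:c:] 1"

lemma rat_fun_value_poly: "rat_fun_value (Fract p 1) a (poly p a)"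
  unfolding rat_fun_value_def by (rule exI[of _ p], rule exI[of _ 1]) simp

lemma rat_fun_value_const: "rat_fun_value (const_fun c) a c"
  using rat_fun_value_poly[of "[:c:]" a] by (simp add: const_fun_def)

lemma rat_fun_value_zero: "rat_fun_value 0 a 0"
  using rat_fun_value_poly[of 0 a] by (simp add: Zero_fract_def)

lemma rat_fun_value_one: "rat_fun_value 1 a 1"
  using rat_fun_value_poly[of 1 a] by (simp add: One_fract_def)

lemma rat_fun_value_add:
  assumes "rat_fun_value \<phi> a c" "rat_fun_value \<psi> a d"
  shows "rat_fun_value (\<phi> + \<psi>) a (c + d)"
proof -
  obtain p q r s where *: "\<phi> = Fract p q" "poly q a \<noteq> 0" "c = poly p a / poly q a"
    "\<psi> = Fract r s" "poly s a \<noteq> 0" "d = poly r a / poly s a"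
    using assms unfolding rat_fun_value_def by blast
  then have "q \<noteq> 0" "s \<noteq> 0" by auto
  then have "\<phi> + \<psi> = Fract (p * s + r * q) (q * s) \<and> poly (q * s) a \<noteq> 0 \<and>
      c + d = poly (p * s + r * q) a / poly (q * s) a"
    unfolding *(1,3,4,6) using *(2,5) by (simp add: add_frac_eq)
  then show ?thesis unfolding rat_fun_value_def by blast
qed

lemma rat_fun_value_mult:
  assumes "rat_fun_value \<phi> a c" "rat_fun_value \<psi> a d"
  shows "rat_fun_value (\<phi> * \<psi>) a (c * d)"
proof -
  obtain p q r s where *: "\<phi> = Fract p q" "poly q a \<noteq> 0" "c = poly p a / poly q a"
    "\<psi> = Fract r s" "poly s a \<noteq> 0" "d = poly r a / poly s a"
    using assms unfolding rat_fun_value_def by blast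
  then have "\<phi> * \<psi> = Fract (p * r) (q * s) \<and> poly (q * s) a \<noteq> 0 \<and>
      c * d = poly (p * r) a / poly (q * s) a"
    by simp
  then show ?thesis unfolding rat_fun_value_def by blast
qed

lemma rat_fun_value_inverse:
  assumes "rat_fun_value \<phi> a c" "c \<noteq> 0"
  shows "rat_fun_value (inverse \<phi>) a (inverse c)"
proof -
  obtain p q where *: "\<phi> = Fract p q" "poly q a \<noteq> 0" "c = poly p a / poly q a"
    using assms unfolding rat_fun_value_def by blast
  then have "inverse \<phi> = Fract q p \<and> poly p a \<noteq> 0 \<and> inverse c = poly q a / poly p a"
    using assms(2) by simp
  then show ?thesis unfolding rat_fun_value_def by blast
qed

lemma rat_fun_value_uminus:
  fixes \<phi> :: "'k::field poly fract"
  assumes "rat_fun_value \<phi> a c"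
  shows "rat_fun_value (- \<phi>) a (- c)"
proof -
  have "const_fun (- 1 :: 'k) = - 1" by (simp add: const_fun_def One_fract_def one_pCons)
  with rat_fun_value_mult[OF rat_fun_value_const assms, of "- 1"] show ?thesis by simp
qed

lemma rat_fun_value_diff:
  "rat_fun_value \<phi> a c \<Longrightarrow> rat_fun_value \<psi> a d \<Longrightarrow> rat_fun_value (\<phi> - \<psi>) a (c - d)"
  using rat_fun_value_add[of \<phi> a c "- \<psi>" "- d"] rat_fun_value_uminus[of \<psi> a d] by simp

lemma rat_fun_value_divide:
  "rat_fun_value \<phi> a c \<Longrightarrow> rat_fun_value \<psi> a d \<Longrightarrow> d \<noteq> 0 \<Longrightarrow> rat_fun_value (\<phi> / \<psi>) a (c / d)"
  using rat_fun_value_mult[of \<phi> a c "inverse \<psi>" "inverse d"] rat_fun_value_inverse[of \<psi> a d]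
  by (simp add: divide_inverse)

lemma rat_fun_value_power: "rat_fun_value \<phi> a c \<Longrightarrow> rat_fun_value (\<phi> ^ n) a (c ^ n)"
  by (induction n) (auto intro: rat_fun_value_one rat_fun_value_mult)

lemmas rat_fun_value_intros =
  rat_fun_value_poly rat_fun_value_const rat_fun_value_zero rat_fun_value_one rat_fun_value_add
  rat_fun_value_mult rat_fun_value_diff rat_fun_value_uminus rat_fun_value_divide rat_fun_value_power

lemma const_fun_nonzero: "c \<noteq> 0 \<Longrightarrow> const_fun c \<noteq> 0"
  by (simp add: const_fun_def Zero_fract_def eq_fract)

text \<open>A nonzero combination of least degree divides every combination, by division with
  remainder.\<close>

lemma poly_Bezout:
  fixes p q :: "'k::field poly"
  assumes "q \<noteq> 0"
  obtains d r s where "d \<noteq> 0" "d dvd p" "d dvd q" "d = r * p + s * q"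
proof -
  let ?P = "\<lambda>d. d \<noteq> 0 \<and> (\<exists>r s. d = r * p + s * q)"
  have "?P q" using assms by (auto intro: exI[of _ 0] exI[of _ 1])
  then obtain d where d: "?P d" and least: "\<And>d'. ?P d' \<Longrightarrow> degree d \<le> degree d'"
    using ex_has_least_nat[of ?P q degree] by blast
  obtain r s where rs: "d = r * p + s * q" using d by blast
  have dvd: "d dvd x" if x: "x = r' * p + s' * q" for x r' s'
  proof (rule ccontr)
    assume "\<not> d dvd x"
    then have nz: "x mod d \<noteq> 0" by (simp add: dvd_eq_mod_eq_0)
    have "x mod d = x - x div d * d" by (simp add: minus_div_mult_eq_mod)
    also have "\<dots> = (r' - x div d * r) * p + (s' - x div d * s) * q"
      by (subst (2) rs, subst x) (simp add: algebra_simps)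
    finally have "degree d \<le> degree (x mod d)" using least nz by blast
    then show False using degree_mod_less[of d x] d nz by auto
  qed
  have "p = 1 * p + 0 * q" "q = 0 * p + 1 * q" by simp_all
  then show ?thesis using that d rs dvd by metis
qed

text \<open>Coprimality is recorded as a Bezout identity because that survives evaluation: numerator
  and denominator have no common zero.\<close>

lemma fract_coprime_cases:
  fixes \<phi> :: "'k::field poly fract"
  obtains p q r s where "\<phi> = Fract p q" "q \<noteq> 0" "r * p + s * q = 1"
proof -
  obtain p q where pq: "\<phi> = Fract p q" "q \<noteq> 0" by (cases \<phi>) auto
  obtain d r s where d: "d \<noteq> 0" "d dvd p" "d dvd q" "d = r * p + s * q"
    using poly_Bezout[OF pq(2)] by blast
  then obtain p' q' where p': "p = d * p'" "q = d * q'" by (elim dvdE)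
  have "d * (r * p' + s * q') = d * 1" using d(4) by (simp add: p' algebra_simps)
  then have "r * p' + s * q' = 1" using d(1) by (metis mult_left_cancel)
  moreover have "\<phi> = Fract p' q'" "q' \<noteq> 0" using pq d(1) p' by (auto simp: eq_fract)
  ultimately show ?thesis using that by blast
qed

section \<open>Ring structure and ideals of \<open>int_rat E A\<close>\<close>

lemma int_ratI: "(\<And>a. a \<in> E \<Longrightarrow> \<exists>c. c \<in> A \<and> rat_fun_value \<phi> a c) \<Longrightarrow> \<phi> \<in> int_rat E A"
  unfolding int_rat_def by blast

lemma int_ratE:
  assumes "\<phi> \<in> int_rat E A" "a \<in> E"
  obtains c where "c \<in> A" "rat_fun_value \<phi> a c"
  using assms unfolding int_rat_def by blast

lemma int_rat_mono: "A \<subseteq> B \<Longrightarrow> int_rat E A \<subseteq> int_rat E B"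
  unfolding int_rat_def by blast

lemma domain_set_int_rat:
  assumes "domain_set A"
  shows "domain_set (int_rat E A)"
proof -
  interpret domain_set A by fact
  show ?thesis
    by unfold_locales
      (blast intro!: int_ratI intro: ring_in rat_fun_value_intros elim!: int_ratE)+
qed

lemma ideal_of_int_rat:
  assumes J: "ideal_of A J"
  shows "ideal_of (int_rat E A) (int_rat E J)"
  unfolding ideal_of_def
proof (intro conjI ballI)
  show "int_rat E J \<subseteq> int_rat E A" using ideal_ofD(1)[OF J] by (intro int_rat_mono) blast
  show "0 \<in> int_rat E J" using ideal_ofD(2)[OF J] rat_fun_value_zero by (blast intro!: int_ratI)
  show "\<phi> + \<psi> \<in> int_rat E J" if "\<phi> \<in> int_rat E J" "\<psi> \<in> int_rat E J" for \<phi> \<psi>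
    using that ideal_ofD(3)[OF J] by (blast intro!: int_ratI intro: rat_fun_value_add elim!: int_ratE)
  show "\<phi> * \<psi> \<in> int_rat E J" if "\<phi> \<in> int_rat E A" "\<psi> \<in> int_rat E J" for \<phi> \<psi>
    using that ideal_ofD(4)[OF J] by (blast intro!: int_ratI intro: rat_fun_value_mult elim!: int_ratE)
qed

lemma radical_of_int_rat:
  assumes J: "radical_of A J"
  shows "radical_of (int_rat E A) (int_rat E J)"
  unfolding radical_of_def
proof (intro conjI ballI allI impI)
  show "ideal_of (int_rat E A) (int_rat E J)" by (rule ideal_of_int_rat[OF radical_ofD(1)[OF J]])
  fix \<phi> n assume \<phi>: "\<phi> \<in> int_rat E A" "\<phi> ^ n \<in> int_rat E J"
  show "\<phi> \<in> int_rat E J"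
  proof (rule int_ratI)
    fix a assume a: "a \<in> E"
    obtain c where c: "c \<in> A" "rat_fun_value \<phi> a c" using int_ratE[OF \<phi>(1) a] .
    obtain d where d: "d \<in> J" "rat_fun_value (\<phi> ^ n) a d" using int_ratE[OF \<phi>(2) a] .
    have "c ^ n = d" by (rule rat_fun_value_unique[OF rat_fun_value_power[OF c(2)] d(2)])
    then have "c \<in> J" using radical_ofD(2)[OF J c(1)] d(1) by blast
    then show "\<exists>c. c \<in> J \<and> rat_fun_value \<phi> a c" using c by blast
  qed
qed

section \<open>Intersections of valuation rings\<close>

text \<open>The same \<open>t\<close> and \<open>n\<close> serve every valuation ring of the family;
  this uniformity lets one rational function work at all points of \<open>E\<close>.\<close>

locale pointed_intersection =
  fixes T :: "'k::field set" and \<V> :: "'k set set" and t :: 'k and n :: nat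
  assumes pointed: "V \<in> \<V> \<Longrightarrow> pointed_valuation V t n"
    and T_iff: "x \<in> T \<longleftrightarrow> (\<forall>V\<in>\<V>. x \<in> V)"
    and nonempty: "\<V> \<noteq> {}"
begin

lemma quotients_in:
  assumes "f \<noteq> 0 \<or> g \<noteq> 0"
  defines "h \<equiv> t * g ^ Suc n + f ^ Suc n"
  shows "h \<noteq> 0" "f ^ Suc n / h \<in> T" "f ^ n * g / h \<in> T" "t * g ^ n * f / h \<in> T"
proof -
  note * = pointed_valuation.homogeneous_denominator_values[OF pointed assms(1)]
  show "h \<noteq> 0" using *(1) nonempty unfolding h_def by blast
  show "f ^ Suc n / h \<in> T" "f ^ n * g / h \<in> T" "t * g ^ n * f / h \<in> T"
    using *(2-4) T_iff unfolding h_def by blast+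
qed

text \<open>\<open>x\<close> lies in every maximal ideal of \<open>T\<close>, not only in the given ones: \<open>1 - x s\<close> is a unit.\<close>

lemma one_minus_unit:
  assumes x: "\<And>V. V \<in> \<V> \<Longrightarrow> x \<in> pointed_valuation.M V" and s: "s \<in> T"
  shows "1 - x * s \<noteq> 0" "inverse (1 - x * s) \<in> T"
proof -
  have *: "1 - x * s \<noteq> 0 \<and> inverse (1 - x * s) \<in> V" if V: "V \<in> \<V>" for V
  proof -
    interpret pointed_valuation V t n by (rule pointed[OF V])
    have "- s \<in> V" using s V T_iff uminus_in by blast
    then have "1 + - s * x \<noteq> 0" "inverse (1 + - s * x) \<in> V"
      using unit_add_M[OF one_in _ _ M_mult[OF _ x[OF V]], of "- s"] one_in by auto
    then show ?thesis by (simp add: mult.commute)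
  qed
  then show "1 - x * s \<noteq> 0" "inverse (1 - x * s) \<in> T" using nonempty T_iff by blast+
qed

text \<open>Regularity gives \<open>x * (1 - x * d) \<in> J\<close>, and the second factor is a unit
  since \<open>x\<close> lies in the Jacobson radical.\<close>

lemma in_regular_ideal:
  assumes J: "ideal_of T J" and reg: "\<And>c. c \<in> T \<Longrightarrow> \<exists>d\<in>T. c - c\<^sup>2 * d \<in> J"
    and x: "\<And>V. V \<in> \<V> \<Longrightarrow> x \<in> pointed_valuation.M V"
  shows "x \<in> J"
proof -
  have "x \<in> T" using x pointed_valuation.M_subset[OF pointed] T_iff by blast
  then obtain d where d: "d \<in> T" "x - x\<^sup>2 * d \<in> J" using reg by blast
  note unit = one_minus_unit[OF x d(1)]
  have "inverse (1 - x * d) * (x - x\<^sup>2 * d) \<in> J" using ideal_ofD(4)[OF J unit(2) d(2)] .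
  moreover have "x - x\<^sup>2 * d = (1 - x * d) * x" by (simp add: power2_eq_square algebra_simps)
  ultimately show ?thesis using unit(1) by (simp add: mult.assoc[symmetric])
qed

text \<open>With \<open>\<psi> = c ^ n / h\<close> the defects are \<open>t * c / h\<close> and
  \<open>\<psi> * t / h\<close>, which lie in the maximal ideal of each valuation ring. Unlike the
  \<open>d\<close> from regularity, \<open>\<psi>\<close> is one fixed expression in
  \<open>c\<close>.\<close>

lemma quasi_inverse:
  assumes J: "ideal_of T J" and reg: "\<And>c. c \<in> T \<Longrightarrow> \<exists>d\<in>T. c - c\<^sup>2 * d \<in> J"
    and c: "c \<in> T"
  defines "h \<equiv> t + c ^ Suc n"
  shows "h \<noteq> 0" "c ^ n / h \<in> T" "c - c\<^sup>2 * (c ^ n / h) \<in> J" "c ^ n / h - (c ^ n / h)\<^sup>2 * c \<in> J"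
proof -
  note * = pointed_valuation.denominator_values[OF pointed, of _ c]
  show h: "h \<noteq> 0" using *(1) nonempty unfolding h_def by blast
  show "c ^ n / h \<in> T" using *(3) T_iff unfolding h_def by blast
  have cV: "c \<in> V" if "V \<in> \<V>" for V using c that T_iff by blast
  have "t * c / h \<in> J" "c ^ n / h * t / h \<in> J"
    unfolding h_def using *(5,6) cV by (intro in_regular_ideal[OF J reg]; blast)+
  moreover have t_eq: "t = h - c ^ n * c" by (simp add: h_def)
  have "c - c\<^sup>2 * (c ^ n / h) = t * c / h" "c ^ n / h - (c ^ n / h)\<^sup>2 * c = c ^ n / h * t / h"
    unfolding t_eq using h by (simp_all add: power2_eq_square field_simps)
  ultimately show "c - c\<^sup>2 * (c ^ n / h) \<in> J" "c ^ n / h - (c ^ n / h)\<^sup>2 * c \<in> J" by simp_all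
qed

text \<open>With \<open>y = f / g\<close> in coprime form,
  \<open>u = y ^ Suc n / (t + y ^ Suc n)\<close> becomes a quotient of polynomials whose denominator
  vanishes nowhere, so it has values at the poles of \<open>y\<close> as well.\<close>

lemma int_rat_split:
  assumes E: "E \<noteq> {}" and y: "y \<noteq> 0"
  shows "\<exists>u\<in>int_rat E T. u / y \<in> int_rat E T \<and> (1 - u) * y \<in> int_rat E T"
proof -
  obtain f g r s where fg: "y = Fract f g" "g \<noteq> 0" "r * f + s * g = 1"
    by (rule fract_coprime_cases)
  define F G where "F = Fract f 1" and "G = Fract g 1"
  define H where "H = const_fun t * G ^ Suc n + F ^ Suc n"
  have FG: "y = F / G" "G \<noteq> 0" "F \<noteq> 0"
    using fg y by (auto simp: F_def G_def Zero_fract_def eq_fract)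
  have nz: "poly f a \<noteq> 0 \<or> poly g a \<noteq> 0" for a
    using arg_cong[OF fg(3), of "\<lambda>p. poly p a"] by auto
  let ?h = "\<lambda>a. t * poly g a ^ Suc n + poly f a ^ Suc n"
  have vals: "rat_fun_value F a (poly f a)" "rat_fun_value G a (poly g a)" "rat_fun_value H a (?h a)" for a
    unfolding H_def F_def G_def by (intro rat_fun_value_intros)+
  have H: "H \<noteq> 0"
    using E quotients_in(1)[OF nz] vals(3) rat_fun_value_unique rat_fun_value_zero by metis
  define u where "u = F ^ Suc n / H"
  have "u / y = F ^ n * G / H" using FG H by (simp add: u_def)
  moreover have "(1 - u) * y = const_fun t * G ^ n * F / H"
  proof -
    have eq: "1 - u = const_fun t * G ^ Suc n / H" using H by (simp add: u_def H_def field_simps)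
    show ?thesis unfolding eq FG(1) using FG(2) by simp
  qed
  moreover have "u \<in> int_rat E T"
    unfolding u_def using quotients_in(1,2)[OF nz] vals by (blast intro!: int_ratI intro: rat_fun_value_intros)
  moreover have "F ^ n * G / H \<in> int_rat E T"
    using quotients_in(1,3)[OF nz] vals by (blast intro!: int_ratI intro: rat_fun_value_intros)
  moreover have "const_fun t * G ^ n * F / H \<in> int_rat E T"
    using quotients_in(1,4)[OF nz] vals by (blast intro!: int_ratI intro: rat_fun_value_intros)
  ultimately show ?thesis by metis
qed

end

text \<open>Over the whole field all polynomials are admissible, and the Bezout identity splits
  \<open>y\<close>: for \<open>u = r * f\<close> the other two elements are \<open>r * g\<close> and
  \<open>s * f\<close>.\<close>

lemma int_rat_UNIV_split:
  fixes y :: "'k::field poly fract"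
  assumes y: "y \<noteq> 0"
  shows "\<exists>u\<in>int_rat E UNIV. u / y \<in> int_rat E UNIV \<and> (1 - u) * y \<in> int_rat E UNIV"
proof -
  obtain f g r s where fg: "y = Fract f g" "g \<noteq> 0" "r * f + s * g = 1"
    by (rule fract_coprime_cases)
  have poly: "Fract p 1 \<in> int_rat E UNIV" for p
    using rat_fun_value_poly by (blast intro: int_ratI)
  have "f \<noteq> 0" using y fg by (auto simp: Zero_fract_def eq_fract)
  then have "Fract (r * f) 1 / y = Fract (r * g) 1" using fg by (simp add: eq_fract)
  moreover have "s * g = 1 - r * f" using fg(3) by (metis add_diff_cancel_left')
  then have "1 - Fract (r * f) 1 = Fract (s * g) 1" by (simp add: One_fract_def)
  then have "(1 - Fract (r * f) 1) * y = Fract (s * f) 1" using fg by (simp add: eq_fract)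
  ultimately show ?thesis using poly by (intro bexI[of _ "Fract (r * f) 1"]) auto
qed

section \<open>Globalized pseudovaluation domains\<close>

lemma unibranched_iff:
  assumes "domain_set A" "domain_set B"
  shows "unibranched A B \<longleftrightarrow> A \<subseteq> B \<and> unibranched_of A B"
  unfolding unibranched_def unibranched_of_def Spec_def
    domain_set.primeideal_iff[OF assms(1)] domain_set.primeideal_iff[OF assms(2)] ..

text \<open>The quasi-inverses modulo \<open>J\<close> carry all conditions on primes: maximality
  above \<open>J\<close> in both rings and the bijection of spectra.\<close>

lemma associated_pruefer_domainI:
  assumes R: "domain_set R" and S: "domain_set S" and RS: "R \<subseteq> S"
    and split: "\<And>y. y \<noteq> 0 \<Longrightarrow> \<exists>u\<in>S. u / y \<in> S \<and> (1 - u) * y \<in> S"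
    and J: "J \<noteq> {0}" "radical_of R J" "radical_of S J"
    and reg: "\<And>c. c \<in> S \<Longrightarrow> \<exists>d\<in>S. c - c\<^sup>2 * d \<in> J \<and> c * d \<in> R \<and> (c \<in> R \<longrightarrow> d \<in> R)"
  shows "associated_pruefer_domain R S"
proof -
  interpret R: domain_set R by fact
  interpret S: domain_set S by fact
  have "pruefer_domain S" by (rule pruefer_domainI[OF S split])
  moreover have "unibranched R S"
    using unibranched_of_common_ideal[OF R S RS radical_ofD(1)[OF J(2)] radical_ofD(1)[OF J(3)] reg] RS
    by (simp add: unibranched_iff[OF R S])
  moreover have "maximal_of S Q" if "prime_of S Q" "J \<subseteq> Q" for Q
    using maximal_of_regular[OF S that] reg by blast
  moreover have "maximal_of R P" if "prime_of R P" "J \<subseteq> P" for P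
    using maximal_of_regular[OF R that] reg RS by blast
  ultimately show ?thesis
    unfolding associated_pruefer_domain_def R.radical_ideal_iff S.radical_ideal_iff
      R.primeideal_iff S.primeideal_iff R.maximalideal_iff S.maximalideal_iff domain_set_iff
    using R J by blast
qed

lemma associated_pruefer_domainE:
  assumes "associated_pruefer_domain D T"
  obtains J where "domain_set D" "domain_set T" "D \<subseteq> T" "unibranched_of D T" "pruefer_domain T"
    "J \<noteq> {0}" "radical_of D J" "radical_of T J"
    "\<And>Q. prime_of T Q \<Longrightarrow> J \<subseteq> Q \<Longrightarrow> maximal_of T Q"
    "\<And>P. prime_of D P \<Longrightarrow> J \<subseteq> P \<Longrightarrow> maximal_of D P"
proof -
  have D: "domain_set D" and T: "domain_set T"
    using assms domain_set_if_pruefer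
    by (auto simp: associated_pruefer_domain_def domain_set_iff)
  interpret D: domain_set D by fact
  interpret T: domain_set T by fact
  obtain J where "unibranched D T" "pruefer_domain T" "J \<noteq> {0}" "radical_of D J" "radical_of T J"
    "\<forall>Q. prime_of T Q \<and> J \<subseteq> Q \<longrightarrow> maximal_of T Q" "\<forall>P. prime_of D P \<and> J \<subseteq> P \<longrightarrow> maximal_of D P"
    using assms
    unfolding associated_pruefer_domain_def D.radical_ideal_iff T.radical_ideal_iff
      D.primeideal_iff T.primeideal_iff D.maximalideal_iff T.maximalideal_iff
    by (elim conjE exE) (rule that)
  then show ?thesis using that[OF D T] unibranched_iff[OF D T] by simp
qed

text \<open>An empty family of maximal ideals is the first case: the empty intersection is the whole
  field.\<close>

lemma singular_cases:
  assumes "singular T" "fraction_field T = UNIV"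
  obtains "T = UNIV" | \<V> t n where "pointed_intersection T \<V> t n"
proof -
  obtain \<Lambda> \<tau> t n where T: "pruefer_domain T" and \<Lambda>: "\<And>m. m \<in> \<Lambda> \<Longrightarrow> maximalideal m (ring_on T)"
    and T_eq: "T = {x \<in> fraction_field T. \<forall>m\<in>\<Lambda>. x \<in> localization_at T m}"
    and \<tau>: "\<And>m. m \<in> \<Lambda> \<Longrightarrow> \<tau> m \<in> localization_at T m"
      "\<And>m. m \<in> \<Lambda> \<Longrightarrow> maximalideal (cgenideal (ring_on (localization_at T m)) (\<tau> m))
        (ring_on (localization_at T m))"
    and less: "\<And>m. m \<in> \<Lambda> \<Longrightarrow> value_less (localization_at T m) (value_zero (localization_at T m))
        (valuation (localization_at T m) t)"
      "\<And>m. m \<in> \<Lambda> \<Longrightarrow> value_less (localization_at T m) (valuation (localization_at T m) t)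
        (value_times (localization_at T m) n (valuation (localization_at T m) (\<tau> m)))"
    using assms(1) unfolding singular_def Let_def by blast
  have T_iff: "x \<in> T \<longleftrightarrow> (\<forall>V\<in>localization_at T ` \<Lambda>. x \<in> V)" for x
    using T_eq assms(2) by blast
  show ?thesis
  proof (cases "\<Lambda> = {}")
    case True
    then show ?thesis using T_eq assms(2) that(1) by simp
  next
    case False
    have "pointed_intersection T (localization_at T ` \<Lambda>) t n"
      using pointed_valuation_localization[OF T assms(2) \<Lambda> \<tau> less] T_iff False
      by (intro pointed_intersection.intro) auto
    then show ?thesis using that(2) by blast
  qed
qed

lemma associated_pruefer_domain_int_rat:
  fixes D T :: "'k::field set"
  assumes DT: "associated_pruefer_domain D T" and "pointed_intersection T \<V> t n" and E: "E \<noteq> {}"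
  shows "associated_pruefer_domain (int_rat E D) (int_rat E T)"
proof -
  obtain J where D: "domain_set D" and T: "domain_set T" and sub: "D \<subseteq> T"
    and unib: "unibranched_of D T" and J: "J \<noteq> {0}" "radical_of D J" "radical_of T J"
    and maxT: "\<And>Q. prime_of T Q \<Longrightarrow> J \<subseteq> Q \<Longrightarrow> maximal_of T Q"
    and maxD: "\<And>P. prime_of D P \<Longrightarrow> J \<subseteq> P \<Longrightarrow> maximal_of D P"
    using associated_pruefer_domainE[OF DT] by metis
  interpret D: domain_set D by fact
  interpret T: domain_set T by fact
  interpret pointed_intersection T \<V> t n by fact
  note JD = radical_ofD(1)[OF J(2)] and JT = radical_ofD(1)[OF J(3)]
  have reg: "\<exists>d\<in>T. c - c\<^sup>2 * d \<in> J" if "c \<in> T" for c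
    using T.regular_mod_radical[OF J(3) maxT that] by metis
  have inj: "P = Q" if "prime_of T P" "prime_of T Q" "P \<inter> D = Q \<inter> D" for P Q
    using unib that unfolding unibranched_of_def bij_betw_def inj_on_def by auto
  \<comment> \<open>\<open>D\<close> is regular modulo \<open>J\<close>, so \<open>c\<close> has a
    quasi-inverse in \<open>D\<close>; uniqueness modulo \<open>J\<close> carries this over to the
    given expression.\<close>
  have quasi: "c ^ n / (t + c ^ Suc n) \<in> D" if c: "c \<in> D" for c
  proof -
    obtain d where d: "d \<in> D" "c - c\<^sup>2 * d \<in> J" using D.regular_mod_radical[OF J(2) maxD c] .
    have "c \<in> T" using c sub by blast
    note q = quasi_inverse[OF JT reg this]
    show ?thesis by (rule quasi_inverse_descends[OF D T sub JD JT c d q(2-4)])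
  qed
  \<comment> \<open>The product of \<open>c\<close> with its quasi-inverse is idempotent modulo
    \<open>J\<close>.\<close>
  have idem: "c * (c ^ n / (t + c ^ Suc n)) \<in> D" if c: "c \<in> T" for c
  proof (rule idempotent_descends[OF D T sub inj JD JT maxD])
    let ?\<psi> = "c ^ n / (t + c ^ Suc n)"
    note q = quasi_inverse[OF JT reg c]
    show "c * ?\<psi> \<in> T" using c q(2) by (rule T.mult_in)
    have "?\<psi> * (c - c\<^sup>2 * ?\<psi>) \<in> J" using ideal_ofD(4)[OF JT q(2,3)] .
    moreover have "?\<psi> * (c - c\<^sup>2 * ?\<psi>) = c * ?\<psi> * (1 - c * ?\<psi>)"
      by (simp add: power2_eq_square right_diff_distrib mult_ac)
    ultimately show "c * ?\<psi> * (1 - c * ?\<psi>) \<in> J" by metis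
  qed
  show ?thesis
  proof (rule associated_pruefer_domainI)
    show "domain_set (int_rat E D)" "domain_set (int_rat E T)"
      using D T by (auto intro: domain_set_int_rat)
    show "int_rat E D \<subseteq> int_rat E T" using sub by (rule int_rat_mono)
    show "\<exists>u\<in>int_rat E T. u / y \<in> int_rat E T \<and> (1 - u) * y \<in> int_rat E T" if "y \<noteq> 0" for y
      using int_rat_split[OF E that] .
    show "radical_of (int_rat E D) (int_rat E J)" "radical_of (int_rat E T) (int_rat E J)"
      using J by (auto intro: radical_of_int_rat)
    obtain j where j: "j \<in> J" "j \<noteq> 0" using J(1) ideal_ofD(2)[OF JD] by blast
    then have "const_fun j \<in> int_rat E J" using rat_fun_value_const by (blast intro: int_ratI)
    then show "int_rat E J \<noteq> {0}" using const_fun_nonzero[OF j(2)] by blast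
    fix \<phi> assume \<phi>: "\<phi> \<in> int_rat E T"
    \<comment> \<open>Since \<open>t\<close> and \<open>n\<close> do not depend on the point, this
      single function takes the quasi-inverse of the value of \<open>\<phi>\<close> at every point
      of \<open>E\<close>.\<close>
    define \<psi> where "\<psi> = \<phi> ^ n / (const_fun t + \<phi> ^ Suc n)"
    have val: "rat_fun_value \<psi> a (c ^ n / (t + c ^ Suc n))" if "rat_fun_value \<phi> a c" "c \<in> T" for a c
      unfolding \<psi>_def using that quasi_inverse(1)[OF JT reg that(2)] by (intro rat_fun_value_intros)
    have "\<psi> \<in> int_rat E T"
    proof (rule int_ratI)
      fix a assume "a \<in> E"
      with \<phi> obtain c where c: "c \<in> T" "rat_fun_value \<phi> a c" by (rule int_ratE)
      then show "\<exists>d. d \<in> T \<and> rat_fun_value \<psi> a d" using val quasi_inverse(2)[OF JT reg] by blast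
    qed
    moreover have "\<phi> - \<phi>\<^sup>2 * \<psi> \<in> int_rat E J"
    proof (rule int_ratI)
      fix a assume "a \<in> E"
      with \<phi> obtain c where c: "c \<in> T" "rat_fun_value \<phi> a c" by (rule int_ratE)
      then have "rat_fun_value (\<phi> - \<phi>\<^sup>2 * \<psi>) a (c - c\<^sup>2 * (c ^ n / (t + c ^ Suc n)))"
        using val by (intro rat_fun_value_intros) auto
      then show "\<exists>d. d \<in> J \<and> rat_fun_value (\<phi> - \<phi>\<^sup>2 * \<psi>) a d"
        using quasi_inverse(3)[OF JT reg c(1)] by blast
    qed
    moreover have "\<phi> * \<psi> \<in> int_rat E D"
    proof (rule int_ratI)
      fix a assume "a \<in> E"
      with \<phi> obtain c where c: "c \<in> T" "rat_fun_value \<phi> a c" by (rule int_ratE)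
      then show "\<exists>d. d \<in> D \<and> rat_fun_value (\<phi> * \<psi>) a d"
        using rat_fun_value_mult[OF c(2) val[OF c(2,1)]] idem by blast
    qed
    moreover have "\<psi> \<in> int_rat E D" if \<phi>D: "\<phi> \<in> int_rat E D"
    proof (rule int_ratI)
      fix a assume "a \<in> E"
      with \<phi>D obtain c where c: "c \<in> D" "rat_fun_value \<phi> a c" by (rule int_ratE)
      then show "\<exists>d. d \<in> D \<and> rat_fun_value \<psi> a d" using val quasi sub by blast
    qed
    ultimately show "\<exists>\<psi>\<in>int_rat E T. \<phi> - \<phi>\<^sup>2 * \<psi> \<in> int_rat E J \<and> \<phi> * \<psi> \<in> int_rat E D \<and>
        (\<phi> \<in> int_rat E D \<longrightarrow> \<psi> \<in> int_rat E D)" by blast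
  qed
qed

text \<open>A nonzero ideal of a field is the field, so \<open>J\<close> and with it
  \<open>D\<close> is everything. The new common ideal is the whole ring, above which there are no
  primes.\<close>

lemma associated_pruefer_domain_int_rat_UNIV:
  fixes D :: "'k::field set"
  assumes "associated_pruefer_domain D UNIV"
  shows "associated_pruefer_domain (int_rat E D) (int_rat E UNIV)"
proof -
  obtain J where D: "domain_set D" and J: "J \<noteq> {0}" "radical_of D J" "radical_of UNIV J"
    using associated_pruefer_domainE[OF assms] by metis
  note JD = radical_ofD(1)[OF J(2)] and JT = radical_ofD(1)[OF J(3)]
  obtain j where j: "j \<in> J" "j \<noteq> 0" using J(1) ideal_ofD(2)[OF JD] by blast
  have "x \<in> D" for x
    using ideal_ofD(4)[OF JT UNIV_I j(1), of "x / j"] ideal_ofD(1)[OF JD] j(2) by simp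
  then have D_UNIV: "D = UNIV" by blast
  let ?R = "int_rat E (UNIV :: 'k set)"
  interpret R: domain_set ?R using D D_UNIV domain_set_int_rat by blast
  have "const_fun 1 \<in> ?R" using rat_fun_value_const by (blast intro: int_ratI)
  then have nz: "?R \<noteq> {0}" using const_fun_nonzero[of 1] by auto
  have rad: "radical_of ?R ?R"
    using R.ring_in unfolding radical_of_def ideal_of_def by auto
  have "associated_pruefer_domain ?R ?R"
  proof (rule associated_pruefer_domainI[OF R.domain_set_axioms R.domain_set_axioms order_refl _ nz rad rad])
    show "\<exists>u\<in>?R. u / y \<in> ?R \<and> (1 - u) * y \<in> ?R" if "y \<noteq> 0" for y
      using that by (rule int_rat_UNIV_split)
    \<comment> \<open>With the whole ring as common ideal, \<open>d = 0\<close> serves.\<close>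
    show "\<exists>d\<in>?R. c - c\<^sup>2 * d \<in> ?R \<and> c * d \<in> ?R \<and> (c \<in> ?R \<longrightarrow> d \<in> ?R)" if "c \<in> ?R" for c
      using that R.zero_in by (intro bexI[of _ 0]) simp_all
  qed
  then show ?thesis by (simp add: D_UNIV)
qed

theorem theorem2p7:
  fixes D T E :: "'k::field set"
  assumes "pseudosingular_gpvd D"
    and "fraction_field D = UNIV"
    and "E \<noteq> {}"
    and "associated_pruefer_domain D T"
  shows "gpvd (int_rat E D) \<and> associated_pruefer_domain (int_rat E D) (int_rat E T)"
proof -
  have "singular T" using assms(1,4) by (simp add: pseudosingular_gpvd_def)
  moreover have "D \<subseteq> T" using assms(4) by (simp add: associated_pruefer_domain_def unibranched_def)
  then have "fraction_field T = UNIV" using assms(2) unfolding fraction_field_def by blast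
  ultimately have "associated_pruefer_domain (int_rat E D) (int_rat E T)"
  proof (cases rule: singular_cases)
    case 1
    then show ?thesis using assms(4) associated_pruefer_domain_int_rat_UNIV by simp
  next
    case (2 \<V> t n)
    then show ?thesis using assms(4) associated_pruefer_domain_int_rat assms(3) by metis
  qed
  then show ?thesis unfolding gpvd_def by blast
qed

end
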